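(* Let $\mu$ be a compactly supported probability measure on $\mathbb{R}$ with infinitely many points in its support, and let $x_0\in\mathbb{R}$ be a strong Lebesgue point of $\mu$. Let $K_n$ be the $n$th Christoffel-Darboux kernel of $\mu$ and $\widetilde{K}_n$ the $n$th second kind Christoffel-Darboux kernel of $\mu$. Assume that, for some positive number $\rho(x_0)$, $$\lim_{n\to\infty}\frac{K_n\left(x_0+\frac{a}{n},x_0+\frac{b}{n}\right)}{n}=\frac{\sin\left(\pi\rho(x_0)(b-a)\right)}{\pi w(x_0)(b-a)}$$ uniformly for $a,b$ in compact subsets of $\mathbb{C}$. Then $$\lim_{n\to\infty}\frac{\widetilde{K}_n\left(x_0+\frac{a}{n},x_0+\frac{b}{n}\right)}{n}=\frac{\sin\left(\pi\rho(x_0)(b-a)\right)}{\pi\widetilde{w}(x_0)(b-a)}$$ uniformly for $a,b$ in compact subsets of $\mathbb{C}$, where $\widetilde{w}(x_0)\neq 0$ is the weight at $x_0$ of the orthogonality measure $\widetilde{\mu}$ of the second kind polynomials of $\mu$.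
   Context: Write $d\mu(x)=w(x)\,dx+d\mu_{\mathrm{sing}}(x)$, where $\mu_{\mathrm{sing}}$ is the part of $\mu$ singular with respect to Lebesgue measure. Let $\{p_n\}_{n=0}^\infty$ be the orthonormal polynomials of $\mu$ (positive leading coefficients, $p_0\equiv 1$) and $\{a_n,b_n\}_{n=1}^\infty$ ($a_n>0$, $b_n\in\mathbb{R}$, bounded) its Jacobi parameters, defined by $xp_n(x)=a_{n+1}p_{n+1}(x)+b_{n+1}p_n(x)+a_np_{n-1}(x)$ for $n\ge 1$ and $xp_0(x)=a_1p_1(x)+b_1p_0(x)$. The assignment $\mu\mapsto\{a_n,b_n\}$ is a bijection between compactly supported probability measures with infinite support and bounded real sequences with all $a_n>0$. The $n$th Christoffel-Darboux kernel is $K_n(x,y)=\sum_{j=0}^{n-1}p_j(x)p_j(y)$, $x,y\in\mathbb{C}$. The second kind polynomials are $q_n(x)=\int\frac{p_n(x)-p_n(t)}{x-t}\,d\mu(t)$ (so $q_0=0$ and $\deg q_n=n-1$ for $n\ge1$), and $\widetilde{K}_n(x,y)=\sum_{j=0}^{n-1}q_j(x)q_j(y)$. The measure $\widetilde{\mu}$ is $\widetilde{\mu}=a_1^2\mu'$, where $\mu'$ is the probability measure with Jacobi parameters $\{a_{n+1},b_{n+1}\}_{n=1}^\infty$; then $q_n$ is the orthonormal polynomial of degree $n-1$ for $\widetilde{\mu}$. With $F_\mu(z)=\int\frac{d\mu(t)}{t-z}$, a point $x_0$ is a strong Lebesgue point for $\mu$ if: (i) $F_\mu(x_0+i0)=\lim_{\varepsilon\to0+}F_\mu(x_0+i\varepsilon)$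 exists and is finite; (ii) $\lim_{\varepsilon\to0+}\frac{\mu(x_0-\varepsilon,x_0+\varepsilon)}{2\varepsilon}=w(x_0)>0$, and $\lim_{\varepsilon\to0+}\frac{1}{2\varepsilon}\int_{x_0-\varepsilon}^{x_0+\varepsilon}|w(t)-w(x_0)|\,dt=0$. The weight $\widetilde{w}$ is the Radon-Nikodym derivative of the absolutely continuous part of $\widetilde{\mu}$, with its value at a strong Lebesgue point $x_0$ of $\mu$ taken to be $\widetilde{w}(x_0)=\frac1\pi\lim_{\varepsilon\to0+}\operatorname{Im}F_{\widetilde{\mu}}(x_0+i\varepsilon)=\frac{w(x_0)}{|F_\mu(x_0+i0)|^2}$, where $F_{\widetilde{\mu}}(z)=\int\frac{d\widetilde{\mu}(t)}{t-z}$. Quotients of the form $\frac{\sin(c(b-a))}{b-a}$ are interpreted at $a=b$ by continuity, i.e. as $c$. *)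

theory Defs
  imports "HOL-Probability.Probability" "HOL-Computational_Algebra.Polynomial"
begin

section \<open>Measures, supports, weights\<close>

definition topological_support :: "real measure \<Rightarrow> real set" where
  "topological_support \<mu> = {x. \<forall>U. open U \<longrightarrow> x \<in> U \<longrightarrow> emeasure \<mu> U > 0}"

definition nontrivial_cpt_prob_measure :: "real measure \<Rightarrow> bool" where
  "nontrivial_cpt_prob_measure \<mu> \<longleftrightarrow>
     prob_space \<mu> \<and> sets \<mu> = sets borel \<and>
     compact (topological_support \<mu>) \<and> infinite (topological_support \<mu>)"

text \<open>
  Lebesgue decomposition \<open>d\<mu> = w dx + d\<mu>\<^sub>s\<^sub>i\<^sub>n\<^sub>g\<close>. The density \<open>w\<close> is determined only
  almost everywhere, so this is a property of the representative \<open>w\<close>.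
\<close>

definition is_ac_weight :: "real measure \<Rightarrow> (real \<Rightarrow> real) \<Rightarrow> bool" where
  "is_ac_weight \<mu> w \<longleftrightarrow>
     w \<in> borel_measurable borel \<and> (\<forall>x. 0 \<le> w x) \<and>
     (\<exists>\<mu>sing. sets \<mu>sing = sets borel \<and>
        (\<exists>N\<in>sets borel. emeasure lborel N = 0 \<and> emeasure \<mu>sing (- N) = 0) \<and>
        (\<forall>A\<in>sets borel.
           emeasure \<mu> A = emeasure (density lborel (\<lambda>x. ennreal (w x))) A + emeasure \<mu>sing A))"

definition stieltjes_transform :: "real measure \<Rightarrow> complex \<Rightarrow> complex" where
  "stieltjes_transform \<mu> z = (LINT t|\<mu>. 1 / (complex_of_real t - z))"

definition strong_Lebesgue_point :: "real measure \<Rightarrow> (real \<Rightarrow> real) \<Rightarrow> real \<Rightarrow> bool" where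
  "strong_Lebesgue_point \<mu> w x0 \<longleftrightarrow>
     (\<exists>L. ((\<lambda>\<epsilon>. stieltjes_transform \<mu> (Complex x0 \<epsilon>)) \<longlongrightarrow> L) (at_right 0)) \<and>
     ((\<lambda>\<epsilon>. measure \<mu> {x0 - \<epsilon><..<x0 + \<epsilon>} / (2 * \<epsilon>)) \<longlongrightarrow> w x0) (at_right 0) \<and>
     w x0 > 0 \<and>
     ((\<lambda>\<epsilon>. (LINT t:{x0 - \<epsilon>..x0 + \<epsilon>}|lborel. \<bar>w t - w x0\<bar>) / (2 * \<epsilon>)) \<longlongrightarrow> 0) (at_right 0)"

text \<open>
  Boundary value of the density, \<open>Lim\<close> being meaningful only where the limit exists. For
  \<open>\<mu>t\<close> the orthogonality measure of the second kind polynomials of \<open>\<mu>\<close>, it does exist at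
  strong Lebesgue points of \<open>\<mu>\<close>, with value \<open>w x0 / |F(x0 + i0)|^2\<close>, where \<open>F\<close> is the
  Stieltjes transform of \<open>\<mu>\<close>.
\<close>

definition boundary_weight :: "real measure \<Rightarrow> real \<Rightarrow> real" where
  "boundary_weight \<mu> x =
     1 / pi * Lim (at_right 0) (\<lambda>\<epsilon>. Im (stieltjes_transform \<mu> (Complex x \<epsilon>)))"

section \<open>Orthonormal polynomials and Jacobi parameters\<close>

definition orthonormal_polys :: "real measure \<Rightarrow> (nat \<Rightarrow> real poly) \<Rightarrow> bool" where
  "orthonormal_polys \<mu> p \<longleftrightarrow>
     (\<forall>n. degree (p n) = n \<and> lead_coeff (p n) > 0) \<and>
     (\<forall>m n. (LINT t|\<mu>. poly (p m) t * poly (p n) t) = (if m = n then 1 else 0))"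

text \<open>
  Jacobi parameters \<open>a n, b n\<close> are indexed by \<open>n \<ge> 1\<close>; the values \<open>a 0\<close> and \<open>b 0\<close> are
  irrelevant. The polynomial \<open>[:0, 1:]\<close> is the variable \<open>x\<close>.
\<close>

definition jacobi_parameters ::
    "real measure \<Rightarrow> (nat \<Rightarrow> real) \<Rightarrow> (nat \<Rightarrow> real) \<Rightarrow> bool" where
  "jacobi_parameters \<mu> a b \<longleftrightarrow>
     (\<forall>n\<ge>1. a n > 0) \<and>
     (\<exists>p. orthonormal_polys \<mu> p \<and>
        [:0, 1:] * p 0 = smult (a 1) (p 1) + smult (b 1) (p 0) \<and>
        (\<forall>n\<ge>1. [:0, 1:] * p n =
           smult (a (n + 1)) (p (n + 1)) + smult (b (n + 1)) (p n) + smult (a n) (p (n - 1))))"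

section \<open>Christoffel-Darboux kernels\<close>

abbreviation cpoly :: "real poly \<Rightarrow> complex \<Rightarrow> complex" where
  "cpoly p \<equiv> poly (map_poly complex_of_real p)"

definition CD_kernel :: "(nat \<Rightarrow> real poly) \<Rightarrow> nat \<Rightarrow> complex \<Rightarrow> complex \<Rightarrow> complex" where
  "CD_kernel p n x y = (\<Sum>j<n. cpoly (p j) x * cpoly (p j) y)"

text \<open>
  The quotient \<open>(p(x) - p(t)) / (x - t)\<close> is a polynomial in \<open>x\<close> and \<open>t\<close>, so its value on
  the diagonal is \<open>p'(x)\<close>; this matters at atoms of the measure.
\<close>

definition difference_quotient :: "real poly \<Rightarrow> complex \<Rightarrow> complex \<Rightarrow> complex" where
  "difference_quotient p x t =
     (if x = t then cpoly (pderiv p) x else (cpoly p x - cpoly p t) / (x - t))"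

definition second_kind :: "real measure \<Rightarrow> real poly \<Rightarrow> complex \<Rightarrow> complex" where
  "second_kind \<mu> p x = (LINT t|\<mu>. difference_quotient p x (complex_of_real t))"

definition second_kind_CD_kernel ::
    "real measure \<Rightarrow> (nat \<Rightarrow> real poly) \<Rightarrow> nat \<Rightarrow> complex \<Rightarrow> complex \<Rightarrow> complex" where
  "second_kind_CD_kernel \<mu> p n x y = (\<Sum>j<n. second_kind \<mu> (p j) x * second_kind \<mu> (p j) y)"

text \<open>\<open>sin (c z) / z\<close>, extended by continuity to \<open>z = 0\<close>.\<close>

definition sin_quotient :: "real \<Rightarrow> complex \<Rightarrow> complex" where
  "sin_quotient c z = (if z = 0 then of_real c else sin (of_real c * z) / z)"

definition sine_kernel_limit ::
    "(nat \<Rightarrow> complex \<Rightarrow> complex \<Rightarrow> complex) \<Rightarrow> real \<Rightarrow> real \<Rightarrow> real \<Rightarrow> bool" where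
  "sine_kernel_limit K x0 \<rho> v \<longleftrightarrow>
     (\<forall>C. compact C \<longrightarrow>
        uniform_limit (C \<times> C)
          (\<lambda>n (a, b). K n (of_real x0 + a / of_nat n) (of_real x0 + b / of_nat n) / of_nat n)
          (\<lambda>(a, b). sin_quotient (pi * \<rho>) (b - a) / of_real (pi * v))
          sequentially)"

end

theory Submission
  imports Defs "HOL-Complex_Analysis.Complex_Analysis"
begin

text \<open>
  Write \<open>P x = (p\<^sub>j x)\<^sub>j\<close> and \<open>Q x = (q\<^sub>j x)\<^sub>j\<close> for the first and second kind solutions of the
  Jacobi recurrence, \<open>[u, v]\<close> for the Wronskian of two solutions at index \<open>n\<close>, and rescale every
  argument as \<open>x0 + a / n\<close>. The Christoffel-Darboux formula turns both kernels into Wronskians,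
  \<open>(a - b) K\<^sub>n(a, b) / n = [P a, P b]\<close> and similarly for \<open>Q\<close>, while \<open>[Q a, P a] = 1\<close>. Wronskians at a
  fixed index are a symplectic form on a plane, so \<open>Q a\<close> can be expanded in the basis
  \<open>P a, P (a + s)\<close>. With \<open>s = 1 / (2 \<rho>)\<close> the determinant \<open>[P a, P (a + s)]\<close> of this basis converges to
  \<open>-1 / (\<pi> w)\<close>, so it stays away from 0. The only coefficient not controlled by the hypothesis on
  \<open>K\<^sub>n\<close> is the entire function \<open>G\<^sub>n a = [Q a, P (a + s)]\<close>; the whole problem is to show that \<open>G\<^sub>n\<close>
  converges.

  The information on \<open>G\<^sub>n\<close> comes from Weyl discs. By Bessel's inequality the solution
  \<open>Q z + F(z) P z\<close>, with \<open>F\<close> the Stieltjes transform of \<open>\<mu>\<close>, has squared norm at most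
  \<open>Im F(z) / Im z\<close>, which by a Pluecker relation says that \<open>[Q z, P \<zeta>] + F(z) [P z, P \<zeta>]\<close>, where
  \<open>\<zeta>\<close> is the conjugate of \<open>z\<close>, lies in the unit disc (\<open>weyl_disc\<close>). Rescaled, this bounds \<open>G\<^sub>n\<close> by
  a multiple of \<open>1 / |Im a|\<close>, and an entire function with such a bound on a circle is bounded inside
  it (\<open>entire_bound_of_real_axis_bound\<close>). So the \<open>G\<^sub>n\<close> form a normal family. The functions
  \<open>F(x0 + a / n)\<close> converge on the upper half plane to the constant \<open>L = F(x0 + i0)\<close>: they form a
  normal family, and converge along the imaginary axis by hypothesis. Hence every limit \<open>g\<close> of a
  subsequence of \<open>G\<^sub>n\<close> lies in the limiting Weyl discs, whose radii tend to 0 as \<open>Im a\<close> grows.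
  By Liouville's theorem \<open>g\<close> is constant, and as it is real on the real line,
  \<open>g = Re L / (\<pi> w)\<close> and \<open>Im L = \<pi> w\<close> (\<open>weyl_disc_rigidity\<close>, \<open>weyl_discs_converge\<close>).

  Substituting the limits in the expansion of \<open>Q a\<close> gives \<open>|L|\<^sup>2 [P a, P b]\<close> as the limit of
  \<open>[Q a, Q b]\<close>, and the maximum principle allows division by \<open>a - b\<close> (\<open>second_kernel_limit\<close>).
  Finally \<open>w(x0) / |L|\<^sup>2\<close> is the boundary weight of the second kind measure by the coefficient
  stripping formula \<open>a\<^sub>1\<^sup>2 F' = b\<^sub>1 - z - 1 / F\<close>, \<open>F'\<close> being the Stieltjes transform of \<open>\<mu>'\<close>. It holds
  because the two Bessel-bounded solutions tend to 0, so that their constant Wronskian vanishes.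
\<close>

section \<open>Solutions of the Jacobi recurrence and Weyl discs\<close>

text \<open>
  The constant \<open>c\<close> takes the place of the term \<open>- a\<^sub>0 u\<^sub>-\<^sub>1\<close>: it is 0 for the first kind polynomials
  and 1 both for the second kind polynomials and for the square summable solution.
\<close>

definition jacobi_solution ::
    "(nat \<Rightarrow> real) \<Rightarrow> (nat \<Rightarrow> real) \<Rightarrow> complex \<Rightarrow> complex \<Rightarrow> (nat \<Rightarrow> complex) \<Rightarrow> bool" where
  "jacobi_solution a b x c u \<longleftrightarrow>
     x * u 0 = of_real (a 1) * u 1 + of_real (b 1) * u 0 - c \<and>
     (\<forall>j\<ge>1. x * u j =
        of_real (a (j + 1)) * u (j + 1) + of_real (b (j + 1)) * u j + of_real (a j) * u (j - 1))"

definition wronskian :: "(nat \<Rightarrow> real) \<Rightarrow> nat \<Rightarrow> (nat \<Rightarrow> complex) \<Rightarrow> (nat \<Rightarrow> complex) \<Rightarrow> complex" where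
  "wronskian a n u v = of_real (a n) * (u n * v (n - 1) - u (n - 1) * v n)"

lemma jacobi_solution_cnj:
  assumes "jacobi_solution a b x c u"
  shows "jacobi_solution a b (cnj x) (cnj c) (\<lambda>j. cnj (u j))"
  unfolding jacobi_solution_def
proof (intro conjI allI impI)
  show "cnj x * cnj (u 0) = of_real (a 1) * cnj (u 1) + of_real (b 1) * cnj (u 0) - cnj c"
    using arg_cong[where f = cnj, OF conjunct1[OF assms[unfolded jacobi_solution_def]]] by simp
  fix j :: nat assume "j \<ge> 1"
  with assms have "x * u j =
        of_real (a (j + 1)) * u (j + 1) + of_real (b (j + 1)) * u j + of_real (a j) * u (j - 1)"
    unfolding jacobi_solution_def by blast
  from arg_cong[where f = cnj, OF this]
  show "cnj x * cnj (u j) = of_real (a (j + 1)) * cnj (u (j + 1)) + of_real (b (j + 1)) * cnj (u j)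
      + of_real (a j) * cnj (u (j - 1))" by simp
qed

lemma jacobi_solution_add_mult:
  assumes "jacobi_solution a b x c u" "jacobi_solution a b x d v"
  shows "jacobi_solution a b x (c + r * d) (\<lambda>j. u j + r * v j)"
  unfolding jacobi_solution_def
proof (intro conjI allI impI)
  have "x * u 0 = of_real (a 1) * u 1 + of_real (b 1) * u 0 - c"
    and "x * v 0 = of_real (a 1) * v 1 + of_real (b 1) * v 0 - d"
    using assms unfolding jacobi_solution_def by blast+
  then show "x * (u 0 + r * v 0) =
      of_real (a 1) * (u 1 + r * v 1) + of_real (b 1) * (u 0 + r * v 0) - (c + r * d)"
    by algebra
  fix j :: nat assume "j \<ge> 1"
  then have "x * u j =
        of_real (a (j + 1)) * u (j + 1) + of_real (b (j + 1)) * u j + of_real (a j) * u (j - 1)"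
    "x * v j =
        of_real (a (j + 1)) * v (j + 1) + of_real (b (j + 1)) * v j + of_real (a j) * v (j - 1)"
    using assms unfolding jacobi_solution_def by blast+
  then show "x * (u j + r * v j) = of_real (a (j + 1)) * (u (j + 1) + r * v (j + 1)) +
      of_real (b (j + 1)) * (u j + r * v j) + of_real (a j) * (u (j - 1) + r * v (j - 1))"
    by algebra
qed

text \<open>
  Multiplying one recurrence by the other solution and subtracting makes the sum telescope. The
  inhomogeneities \<open>c\<close> and \<open>d\<close> survive as boundary terms at index 0, which lets one formula cover both
  kernels, the mixed kernel, and (for \<open>x = y\<close>) the constancy of the Wronskian.
\<close>

lemma christoffel_darboux:
  assumes u: "jacobi_solution a b x c u" and v: "jacobi_solution a b y d v" and "n \<ge> 1"
  shows "(x - y) * (\<Sum>j<n. u j * v j) = wronskian a n u v - c * v 0 + d * u 0"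
  using \<open>n \<ge> 1\<close>
proof (induction n rule: dec_induct)
  case base
  have "x * u 0 = of_real (a 1) * u 1 + of_real (b 1) * u 0 - c"
    and "y * v 0 = of_real (a 1) * v 1 + of_real (b 1) * v 0 - d"
    using u v unfolding jacobi_solution_def by blast+
  then have "(x - y) * (u 0 * v 0) = of_real (a 1) * (u 1 * v 0 - u 0 * v 1) - c * v 0 + d * u 0"
    by algebra
  then show ?case by (simp add: wronskian_def)
next
  case (step n)
  have "x * u n =
        of_real (a (n + 1)) * u (n + 1) + of_real (b (n + 1)) * u n + of_real (a n) * u (n - 1)"
    "y * v n =
        of_real (a (n + 1)) * v (n + 1) + of_real (b (n + 1)) * v n + of_real (a n) * v (n - 1)"
    using u v step(1) unfolding jacobi_solution_def by blast+
  then have "(x - y) * (u n * v n) = wronskian a (Suc n) u v - wronskian a n u v"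
    unfolding wronskian_def by simp algebra
  moreover have "(x - y) * (\<Sum>j<Suc n. u j * v j) =
      (x - y) * (\<Sum>j<n. u j * v j) + (x - y) * (u n * v n)"
    by (simp add: distrib_left)
  ultimately show ?case using step.IH by simp
qed

text \<open>
  At a fixed index all Wronskians are \<open>2 \<times> 2\<close> determinants, so that any four vectors satisfy the
  Pluecker relation. Every algebraic manipulation of kernels below is an instance of it.
\<close>

lemma wronskian_pluecker:
  "wronskian a n u v * wronskian a n s t - wronskian a n u s * wronskian a n v t
     + wronskian a n u t * wronskian a n v s = 0"
  unfolding wronskian_def by algebra

lemma wronskian_commute: "wronskian a n v u = - wronskian a n u v"
  unfolding wronskian_def by algebra

lemma wronskian_cnj: "cnj (wronskian a n u v) = wronskian a n (\<lambda>j. cnj (u j)) (\<lambda>j. cnj (v j))"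
  unfolding wronskian_def by simp

lemma wronskian_add_mult:
  "wronskian a n (\<lambda>j. u j + r * v j) s = wronskian a n u s + r * wronskian a n v s"
  unfolding wronskian_def by algebra

text \<open>
  With \<open>u = q + F p\<close> and \<open>d = [u, p']\<close>, where a prime marks complex conjugation, the Pluecker relation
  is \<open>[u, u'] [p, p'] = 1 - |d|\<^sup>2\<close>. By Christoffel-Darboux both factors on the left are purely
  imaginary: \<open>[p, p']\<close> lies on the upper half axis, and the norm bound on \<open>u\<close> says exactly that
  \<open>[u, u']\<close> lies on the lower one. So their product is nonnegative and \<open>|d| \<le> 1\<close>.
\<close>

lemma weyl_disc:
  assumes p: "jacobi_solution a b z 0 p" and q: "jacobi_solution a b z 1 q"
    and p0: "p 0 = 1" and q0: "q 0 = 0" and n: "n \<ge> 1" and z: "Im z > 0"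
    and le: "(\<Sum>j<n. (cmod (q j + F * p j))\<^sup>2) \<le> Im F / Im z"
  shows "cmod (wronskian a n q (\<lambda>j. cnj (p j)) + F * wronskian a n p (\<lambda>j. cnj (p j))) \<le> 1"
proof -
  define u where "u = (\<lambda>j. q j + F * p j)"
  define u' where "u' = (\<lambda>j. cnj (u j))"
  define p' where "p' = (\<lambda>j. cnj (p j))"
  have u: "jacobi_solution a b z 1 u"
    using jacobi_solution_add_mult[OF q p, of F] by (simp add: u_def)
  have u0: "u 0 = F" by (simp add: u_def p0 q0)
  have zz: "z - cnj z = 2 * \<i> * Im z" by (simp add: complex_eq_iff)
  have uu: "wronskian a n u u' =
      2 * \<i> * of_real (Im z * (\<Sum>j<n. (cmod (u j))\<^sup>2) - Im F)"
  proof -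
    have "(z - cnj z) * (\<Sum>j<n. u j * u' j) = wronskian a n u u' - cnj F + F"
      using christoffel_darboux[OF u jacobi_solution_cnj[OF u] n] by (simp add: u'_def u0)
    then have "wronskian a n u u' = (z - cnj z) * (\<Sum>j<n. u j * u' j) - (F - cnj F)"
      by algebra
    moreover have "(\<Sum>j<n. u j * u' j) = of_real (\<Sum>j<n. (cmod (u j))\<^sup>2)"
      by (simp only: u'_def of_real_sum complex_norm_square)
    moreover have "F - cnj F = 2 * \<i> * Im F" by (simp add: complex_eq_iff)
    ultimately show ?thesis unfolding zz by (simp add: right_diff_distrib)
  qed
  have pp: "wronskian a n p p' = 2 * \<i> * of_real (Im z * (\<Sum>j<n. (cmod (p j))\<^sup>2))"
  proof -
    have "(z - cnj z) * (\<Sum>j<n. p j * p' j) = wronskian a n p p'"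
      using christoffel_darboux[OF p jacobi_solution_cnj[OF p] n] by (simp add: p'_def)
    moreover have "(\<Sum>j<n. p j * p' j) = of_real (\<Sum>j<n. (cmod (p j))\<^sup>2)"
      by (simp only: p'_def of_real_sum complex_norm_square)
    ultimately show ?thesis using zz by (simp add: algebra_simps)
  qed
  have up: "wronskian a n u p = 1"
    using christoffel_darboux[OF u p n] by (simp add: p0)
  have up': "wronskian a n u' p' = 1"
    using arg_cong[OF up, of cnj] by (simp add: wronskian_cnj u'_def p'_def)
  define d where "d = wronskian a n u p'"
  have u'p: "wronskian a n u' p = cnj d"
    unfolding d_def wronskian_cnj by (simp add: u'_def p'_def wronskian_def)
  have prod: "wronskian a n u u' * wronskian a n p p' = 1 - d * cnj d"
  proof -
    have "wronskian a n u u' * wronskian a n p p' - wronskian a n u p * wronskian a n u' p'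
     + wronskian a n u p' * wronskian a n u' p = 0"
      by (rule wronskian_pluecker)
    then show ?thesis using u'p up up' by (simp add: d_def algebra_simps)
  qed
  define X where "X = Im z * (\<Sum>j<n. (cmod (u j))\<^sup>2) - Im F"
  define Y where "Y = Im z * (\<Sum>j<n. (cmod (p j))\<^sup>2)"
  have "1 - d * cnj d = of_real (- 4 * (X * Y))"
    using prod unfolding uu pp X_def[symmetric] Y_def[symmetric] by (simp add: algebra_simps)
  moreover have "X * Y \<le> 0"
  proof (rule mult_nonpos_nonneg)
    show "X \<le> 0" using le z by (simp add: X_def u_def field_simps)
    show "Y \<ge> 0" using z by (simp add: Y_def sum_nonneg)
  qed
  ultimately have "\<exists>r::real. r \<ge> 0 \<and> 1 - d * cnj d = of_real r"
    by (intro exI[of _ "- 4 * (X * Y)"]) simp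
  then obtain r :: real where r: "r \<ge> 0" "1 - d * cnj d = of_real r" by blast
  then have "of_real ((cmod d)\<^sup>2) = (of_real (1 - r) :: complex)"
    by (simp only: complex_norm_square) (simp add: algebra_simps)
  then have "(cmod d)\<^sup>2 = 1 - r" by (simp only: of_real_eq_iff)
  then have "cmod d \<le> 1" using r(1) by (intro power2_le_imp_le[of "cmod d" 1]) auto
  then show ?thesis by (simp add: d_def p'_def u_def wronskian_add_mult)
qed

section \<open>Compactly supported measures and their orthonormal polynomials\<close>

text \<open>
  The complement of the support is a union of open null sets; by the Lindelof property countably many
  of them suffice.
\<close>

lemma AE_in_topological_support:
  fixes \<mu> :: "real measure"
  assumes sets: "sets \<mu> = sets borel"
  shows "AE t in \<mu>. t \<in> topological_support \<mu>"
proof -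
  define U where "U = {V :: real set. open V \<and> emeasure \<mu> V = 0}"
  obtain U' where U': "U' \<subseteq> U" "countable U'" "\<Union>U' = \<Union>U"
    using Lindelof[of U] unfolding U_def by blast
  have null: "\<Union>U' \<in> null_sets \<mu>"
  proof -
    have "(\<Union>V\<in>U'. V) \<in> null_sets \<mu>"
      using U' sets by (intro null_sets_UN') (auto simp: U_def null_sets_def)
    then show ?thesis by simp
  qed
  have "t \<in> topological_support \<mu>" if "t \<notin> \<Union>U'" for t
  proof -
    have "emeasure \<mu> V > 0" if "open V" "t \<in> V" for V
      using that \<open>t \<notin> \<Union>U'\<close> U' by (auto simp: U_def zero_less_iff_neq_zero)
    then show ?thesis by (simp add: topological_support_def)
  qed
  then show ?thesis using AE_not_in[OF null] by (auto elim: eventually_mono)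
qed

lemma AE_bounded:
  assumes "nontrivial_cpt_prob_measure \<mu>"
  obtains R where "AE t in \<mu>. \<bar>t\<bar> \<le> R"
proof -
  have "bounded (topological_support \<mu>)"
    using assms compact_imp_bounded unfolding nontrivial_cpt_prob_measure_def by blast
  then obtain R where "\<forall>t\<in>topological_support \<mu>. \<bar>t\<bar> \<le> R"
    unfolding bounded_iff by auto
  moreover have "AE t in \<mu>. t \<in> topological_support \<mu>"
    using assms AE_in_topological_support unfolding nontrivial_cpt_prob_measure_def by blast
  ultimately show ?thesis by (intro that[of R]) (auto elim: eventually_mono)
qed

text \<open>
  The source of all integrability facts below: the measure lives on a compact interval.
\<close>

lemma integrable_continuous:
  fixes f :: "real \<Rightarrow> 'b :: {banach, second_countable_topology}"
  assumes \<mu>: "nontrivial_cpt_prob_measure \<mu>" and f: "continuous_on UNIV f"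
  shows "integrable \<mu> f"
proof -
  interpret prob_space \<mu> using \<mu> unfolding nontrivial_cpt_prob_measure_def by blast
  have sets: "sets \<mu> = sets borel" using \<mu> unfolding nontrivial_cpt_prob_measure_def by blast
  obtain R where R: "AE t in \<mu>. \<bar>t\<bar> \<le> R" using AE_bounded[OF \<mu>] .
  have "compact (f ` {-R..R})"
    using f by (intro compact_continuous_image continuous_on_subset[OF f]) auto
  then obtain B where B: "\<forall>x\<in>{-R..R}. norm (f x) \<le> B"
    using compact_imp_bounded bounded_iff by (metis image_eqI)
  have "f \<in> borel_measurable borel" using f by (rule borel_measurable_continuous_onI)
  then have "f \<in> borel_measurable \<mu>" using measurable_cong_sets[OF sets refl] by blast
  moreover have "AE t in \<mu>. norm (f t) \<le> B"
    using R by eventually_elim (rule B[rule_format], simp add: abs_le_iff)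
  ultimately show ?thesis by (intro integrable_const_bound[where B = B]) auto
qed

lemma orthogonal_to_lower_degree:
  assumes \<mu>: "nontrivial_cpt_prob_measure \<mu>" and p: "orthonormal_polys \<mu> p"
    and "degree r < n \<or> r = 0"
  shows "(LINT t|\<mu>. poly r t * poly (p n) t) = 0"
  using assms(3)
proof (induction "degree r" arbitrary: r rule: less_induct)
  case less
  show ?case
  proof (cases "r = 0")
    case False
    then have deg: "degree r < n" using less.prems by blast
    define d where "d = degree r"
    define c where "c = lead_coeff r / lead_coeff (p d)"
    define s where "s = r - smult c (p d)"
    have pd: "degree (p d) = d" "lead_coeff (p d) > 0"
      using p unfolding orthonormal_polys_def by blast+
    have "coeff s d = 0" using pd by (simp add: s_def c_def d_def)
    moreover have "degree s \<le> d" unfolding s_def using pd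
      by (intro degree_diff_le) (auto simp: d_def)
    ultimately have s: "degree s < d \<or> s = 0"
      by (metis le_neq_implies_less leading_coeff_0_iff)
    have int: "integrable \<mu> (\<lambda>t. poly f t * poly g t)" for f g
      by (intro integrable_continuous[OF \<mu>] continuous_intros)
    have "r = smult c (p d) + s" by (simp add: s_def)
    then have "(LINT t|\<mu>. poly r t * poly (p n) t) =
        (LINT t|\<mu>. c * (poly (p d) t * poly (p n) t) + poly s t * poly (p n) t)"
      by (simp add: algebra_simps)
    also have "\<dots> = c * (LINT t|\<mu>. poly (p d) t * poly (p n) t) + (LINT t|\<mu>. poly s t * poly (p n) t)"
      using int by simp
    also have "(LINT t|\<mu>. poly (p d) t * poly (p n) t) = 0"
      using p deg unfolding orthonormal_polys_def d_def by auto
    also have "(LINT t|\<mu>. poly s t * poly (p n) t) = 0"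
    proof (cases "s = 0")
      case False
      then show ?thesis using less.hyps[of s] s deg unfolding d_def by auto
    qed simp
    finally show ?thesis by simp
  qed simp
qed

lemma integral_mult_same_degree:
  assumes \<mu>: "nontrivial_cpt_prob_measure \<mu>" and p: "orthonormal_polys \<mu> p"
  shows "(LINT t|\<mu>. poly r t * poly (p (degree r)) t) = lead_coeff r / lead_coeff (p (degree r))"
proof -
  define d where "d = degree r"
  define e where "e = lead_coeff r / lead_coeff (p d)"
  define s where "s = r - smult e (p d)"
  have pd: "degree (p d) = d" "lead_coeff (p d) > 0"
    using p unfolding orthonormal_polys_def by blast+
  have int: "integrable \<mu> (\<lambda>t. poly f t * poly g t)" for f g
    by (intro integrable_continuous[OF \<mu>] continuous_intros)
  have "coeff s d = 0" using pd by (simp add: s_def e_def d_def)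
  moreover have "degree s \<le> d" unfolding s_def using pd
    by (intro degree_diff_le) (auto simp: d_def)
  ultimately have s: "degree s < d \<or> s = 0"
    by (metis le_neq_implies_less leading_coeff_0_iff)
  have pdd: "(LINT t|\<mu>. poly (p d) t * poly (p d) t) = 1"
    using p unfolding orthonormal_polys_def by auto
  have "r = smult e (p d) + s" by (simp add: s_def)
  then have "(LINT t|\<mu>. poly r t * poly (p d) t) =
      (LINT t|\<mu>. e * (poly (p d) t * poly (p d) t) + poly s t * poly (p d) t)"
    by (metis (no_types, lifting) distrib_right mult.assoc poly_add poly_smult)
  also have "\<dots> = e * (LINT t|\<mu>. poly (p d) t * poly (p d) t) + (LINT t|\<mu>. poly s t * poly (p d) t)"
    using int by simp
  also have "\<dots> = e" using pdd orthogonal_to_lower_degree[OF \<mu> p s] by simp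
  finally show ?thesis by (simp add: d_def e_def)
qed

text \<open>
  Needed because \<open>jacobi_parameters\<close> speaks of some orthonormal family: its recurrence must be
  transferred to the given one. Subtracting the right multiple of \<open>p n\<close> from \<open>p' n\<close> leaves a
  polynomial of degree less than \<open>n\<close> that is orthogonal to all such polynomials. If it were nonzero,
  its product with the orthonormal polynomial of its own degree would have a nonzero integral.
\<close>

lemma orthonormal_polys_unique:
  assumes \<mu>: "nontrivial_cpt_prob_measure \<mu>"
    and p: "orthonormal_polys \<mu> p" and p': "orthonormal_polys \<mu> p'"
  shows "p' = p"
proof
  fix n
  have pn: "degree (p k) = k" "lead_coeff (p k) > 0" "degree (p' k) = k" "lead_coeff (p' k) > 0" for k
    using p p' unfolding orthonormal_polys_def by blast+
  define c where "c = lead_coeff (p' n) / lead_coeff (p n)"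
  have c: "c > 0" using pn[of n] by (simp add: c_def)
  define r where "r = p' n - smult c (p n)"
  have int: "integrable \<mu> (\<lambda>t. poly f t * poly g t)" for f g
    by (intro integrable_continuous[OF \<mu>] continuous_intros)
  have "coeff r n = 0"
    using pn(1)[of n] pn(2)[of n] pn(3)[of n] by (simp add: r_def c_def)
  moreover have "degree r \<le> n" unfolding r_def using pn(1)[of n] pn(3)[of n]
    by (intro degree_diff_le) auto
  ultimately have deg: "degree r < n \<or> r = 0"
    by (metis le_neq_implies_less leading_coeff_0_iff)
  have "r = 0"
  proof (rule ccontr)
    assume "r \<noteq> 0"
    define d where "d = degree r"
    have d: "d < n" using deg \<open>r \<noteq> 0\<close> d_def by blast
    have 1: "(LINT t|\<mu>. poly r t * poly (p d) t) = lead_coeff r / lead_coeff (p d)"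
      unfolding d_def by (rule integral_mult_same_degree[OF \<mu> p])
    have "(LINT t|\<mu>. poly r t * poly (p d) t) =
        (LINT t|\<mu>. poly (p d) t * poly (p' n) t - c * (poly (p d) t * poly (p n) t))"
      by (simp add: r_def algebra_simps)
    also have "\<dots> = (LINT t|\<mu>. poly (p d) t * poly (p' n) t) - c * (LINT t|\<mu>. poly (p d) t * poly (p n) t)"
      using int by simp
    also have "\<dots> = 0"
      using orthogonal_to_lower_degree[OF \<mu> p, of "p d" n]
        orthogonal_to_lower_degree[OF \<mu> p', of "p d" n] d pn(1)[of d] by simp
    finally show False using \<open>r \<noteq> 0\<close> pn(2)[of d] 1 by simp
  qed
  then have eq: "p' n = smult c (p n)" by (simp add: r_def)
  have "1 = (LINT t|\<mu>. poly (p' n) t * poly (p' n) t)"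
    using p' unfolding orthonormal_polys_def by simp
  also have "\<dots> = (LINT t|\<mu>. c\<^sup>2 * (poly (p n) t * poly (p n) t))"
    unfolding eq by (simp add: power2_eq_square mult_ac)
  also have "\<dots> = c\<^sup>2" using p unfolding orthonormal_polys_def by simp
  finally have "c = 1" using c by (metis less_eq_real_def one_power2 power2_eq_iff_nonneg zero_le_one)
  then show "p' n = p n" using eq by simp
qed

lemma jacobi_recurrence:
  assumes "nontrivial_cpt_prob_measure \<mu>" "orthonormal_polys \<mu> p" "jacobi_parameters \<mu> a b"
  shows "[:0, 1:] * p 0 = smult (a 1) (p 1) + smult (b 1) (p 0)"
    and "n \<ge> 1 \<Longrightarrow> [:0, 1:] * p n =
           smult (a (n + 1)) (p (n + 1)) + smult (b (n + 1)) (p n) + smult (a n) (p (n - 1))"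
  using assms orthonormal_polys_unique[OF assms(1,2)] unfolding jacobi_parameters_def by blast+

lemma orthonormal_poly_0:
  assumes \<mu>: "nontrivial_cpt_prob_measure \<mu>" and p: "orthonormal_polys \<mu> p"
  shows "p 0 = 1"
proof -
  interpret prob_space \<mu> using \<mu> unfolding nontrivial_cpt_prob_measure_def by blast
  have "degree (p 0) = 0" using p unfolding orthonormal_polys_def by blast
  then obtain k where k: "p 0 = [:k:]" by (rule degree_eq_zeroE)
  have "k > 0" using p k unfolding orthonormal_polys_def
    by (metis coeff_pCons_0)
  moreover have "(LINT t|\<mu>. poly (p 0) t * poly (p 0) t) = 1"
    using p unfolding orthonormal_polys_def by simp
  then have "k * k = 1" by (simp add: k prob_space)
  ultimately have "k = 1"
    by (simp add: square_eq_1_iff)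
  then show ?thesis using k by (simp add: one_pCons)
qed

text \<open>
  \<open>a (n + 1)\<close> is the integral of \<open>t p\<^sub>n(t) p\<^sub>n\<^sub>+\<^sub>1(t)\<close>, where \<open>|t|\<close> is bounded and
  \<open>2 |p\<^sub>n p\<^sub>n\<^sub>+\<^sub>1| \<le> p\<^sub>n\<^sup>2 + p\<^sub>n\<^sub>+\<^sub>1\<^sup>2\<close> has integral at most 2.
\<close>

lemma jacobi_parameters_bounded:
  assumes \<mu>: "nontrivial_cpt_prob_measure \<mu>" and p: "orthonormal_polys \<mu> p"
    and ab: "jacobi_parameters \<mu> a b"
  obtains R where "\<And>n. n \<ge> 1 \<Longrightarrow> \<bar>a n\<bar> \<le> R"
proof -
  obtain R where R: "AE t in \<mu>. \<bar>t\<bar> \<le> R" using AE_bounded[OF \<mu>] .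
  have int: "integrable \<mu> (\<lambda>t. poly f t * poly g t)" for f g
    by (intro integrable_continuous[OF \<mu>] continuous_intros)
  have orth: "(LINT t|\<mu>. poly (p m) t * poly (p n) t) = (if m = n then 1 else 0)" for m n
    using p unfolding orthonormal_polys_def by blast
  have "\<bar>a (n + 1)\<bar> \<le> R" for n
  proof -
    have "(LINT t|\<mu>. poly ([:0, 1:] * p n) t * poly (p (n + 1)) t) = a (n + 1)"
    proof (cases "n = 0")
      case True
      then have *: "[:0, 1:] * p n = smult (a (n + 1)) (p (n + 1)) + smult (b (n + 1)) (p n)"
        using jacobi_recurrence(1)[OF assms] by simp
      have "(LINT t|\<mu>. poly ([:0, 1:] * p n) t * poly (p (n + 1)) t) =
        (LINT t|\<mu>. a (n + 1) * (poly (p (n + 1)) t * poly (p (n + 1)) t) +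
            b (n + 1) * (poly (p n) t * poly (p (n + 1)) t))"
        unfolding * by (simp add: algebra_simps)
      also have "\<dots> = a (n + 1)" using int by (simp add: orth)
      finally show ?thesis .
    next
      case False
      then have *: "[:0, 1:] * p n = smult (a (n + 1)) (p (n + 1)) + smult (b (n + 1)) (p n)
          + smult (a n) (p (n - 1))"
        using jacobi_recurrence(2)[OF assms, of n] by simp
      have "(LINT t|\<mu>. poly ([:0, 1:] * p n) t * poly (p (n + 1)) t) =
        (LINT t|\<mu>. a (n + 1) * (poly (p (n + 1)) t * poly (p (n + 1)) t) +
            b (n + 1) * (poly (p n) t * poly (p (n + 1)) t) +
            a n * (poly (p (n - 1)) t * poly (p (n + 1)) t))"
        unfolding * by (simp add: algebra_simps)
      also have "\<dots> = a (n + 1)" using int by (simp add: orth)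
      finally show ?thesis .
    qed
    then have "\<bar>a (n + 1)\<bar> \<le> (LINT t|\<mu>. \<bar>poly ([:0, 1:] * p n) t * poly (p (n + 1)) t\<bar>)"
      using integral_abs_bound by metis
    also have "\<dots> \<le> (LINT t|\<mu>. R * ((poly (p n) t * poly (p n) t +
        poly (p (n + 1)) t * poly (p (n + 1)) t) / 2))"
    proof (rule integral_mono_AE)
      show "integrable \<mu> (\<lambda>t. \<bar>poly ([:0, 1:] * p n) t * poly (p (n + 1)) t\<bar>)"
        using int integrable_abs by blast
      show "integrable \<mu> (\<lambda>t. R * ((poly (p n) t * poly (p n) t +
        poly (p (n + 1)) t * poly (p (n + 1)) t) / 2))"
        using int by simp
      show "AE t in \<mu>. \<bar>poly ([:0, 1:] * p n) t * poly (p (n + 1)) t\<bar> \<le>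
        R * ((poly (p n) t * poly (p n) t + poly (p (n + 1)) t * poly (p (n + 1)) t) / 2)"
        using R
      proof eventually_elim
        fix t assume t: "\<bar>t\<bar> \<le> R"
        have "\<bar>poly (p n) t * poly (p (n + 1)) t\<bar> \<le>
            (poly (p n) t * poly (p n) t + poly (p (n + 1)) t * poly (p (n + 1)) t) / 2"
          using sum_squares_bound[of "\<bar>poly (p n) t\<bar>" "\<bar>poly (p (n + 1)) t\<bar>"]
          by (simp add: power2_eq_square abs_mult)
        then have "\<bar>t\<bar> * \<bar>poly (p n) t * poly (p (n + 1)) t\<bar> \<le>
            R * ((poly (p n) t * poly (p n) t + poly (p (n + 1)) t * poly (p (n + 1)) t) / 2)"
          using t by (intro mult_mono) auto
        then show "\<bar>poly ([:0, 1:] * p n) t * poly (p (n + 1)) t\<bar> \<le>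
          R * ((poly (p n) t * poly (p n) t + poly (p (n + 1)) t * poly (p (n + 1)) t) / 2)"
          by (simp add: abs_mult mult.assoc)
      qed
    qed
    also have "\<dots> = R" using int by (simp add: orth)
    finally show ?thesis .
  qed
  then have "\<bar>a n\<bar> \<le> R" if "n \<ge> 1" for n
    using that by (metis add.commute le_Suc_ex plus_1_eq_Suc add_diff_inverse_nat not_less)
  then show ?thesis by (rule that)
qed

section \<open>Second kind polynomials\<close>

lemma cpoly_add: "cpoly (p + q) x = cpoly p x + cpoly q x"
proof -
  have "map_poly complex_of_real (p + q) = map_poly complex_of_real p + map_poly complex_of_real q"
    by (intro poly_eqI) (simp add: coeff_map_poly)
  then show ?thesis by simp
qed

lemma cpoly_smult: "cpoly (smult c p) x = of_real c * cpoly p x"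
  by (simp add: map_poly_smult)

lemma cpoly_pCons: "cpoly (pCons c p) x = of_real c + x * cpoly p x"
  by (simp add: map_poly_pCons)

lemma cpoly_of_real: "cpoly p (of_real t) = of_real (poly p t)"
  by (induction p) (simp_all add: map_poly_pCons)

lemma cpoly_cnj: "cpoly p (cnj x) = cnj (cpoly p x)"
  by (induction p) (simp_all add: map_poly_pCons)

lemma difference_quotient_add:
  "difference_quotient (p + q) x t = difference_quotient p x t + difference_quotient q x t"
  by (simp add: difference_quotient_def cpoly_add pderiv_add diff_divide_distrib add_divide_distrib)

lemma difference_quotient_smult:
  "difference_quotient (smult c p) x t = of_real c * difference_quotient p x t"
  by (simp add: difference_quotient_def cpoly_smult pderiv_smult diff_divide_distrib
      right_diff_distrib)

text \<open>
  The recurrence behind everything else about second kind polynomials: multiplying \<open>p\<close> by the variable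
  (the case \<open>c = 0\<close>) multiplies the quotient by \<open>x\<close> up to the term \<open>p(t)\<close>, whose integral vanishes when
  \<open>p\<close> is orthogonal to the constants.
\<close>

lemma difference_quotient_pCons:
  "difference_quotient (pCons c p) x t = cpoly p t + x * difference_quotient p x t"
proof (cases "x = t")
  case True
  then show ?thesis by (simp add: difference_quotient_def pderiv_pCons cpoly_add cpoly_pCons)
next
  case False
  then have "x - t \<noteq> 0" by simp
  then show ?thesis using False
    by (simp add: difference_quotient_def cpoly_pCons divide_simps) (simp add: algebra_simps)
qed

lemma difference_quotient_const:
  "difference_quotient 0 x t = 0" "difference_quotient 1 x t = 0"
  by (auto simp: difference_quotient_def)

lemma continuous_on_difference_quotient:
  "continuous_on UNIV (\<lambda>t. difference_quotient p x (complex_of_real t))"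
proof (induction p)
  case 0
  then show ?case by (simp add: difference_quotient_const)
next
  case (pCons c p)
  then show ?case by (simp add: difference_quotient_pCons cpoly_of_real) (intro continuous_intros)
qed

lemma second_kind_jacobi_solution:
  assumes \<mu>: "nontrivial_cpt_prob_measure \<mu>" and p: "orthonormal_polys \<mu> p"
    and ab: "jacobi_parameters \<mu> a b"
  shows "jacobi_solution a b x 1 (\<lambda>j. second_kind \<mu> (p j) x)"
    and "second_kind \<mu> (p 0) x = 0"
proof -
  interpret prob_space \<mu> using \<mu> unfolding nontrivial_cpt_prob_measure_def by blast
  have p0: "p 0 = 1" using orthonormal_poly_0[OF \<mu> p] .
  show q0: "second_kind \<mu> (p 0) x = 0"
    by (simp add: p0 second_kind_def difference_quotient_const)
  have int: "integrable \<mu> (\<lambda>t. difference_quotient r x (complex_of_real t))" for r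
    by (rule integrable_continuous[OF \<mu> continuous_on_difference_quotient])
  have intp: "integrable \<mu> (\<lambda>t. complex_of_real (poly r t))" for r
    by (intro integrable_continuous[OF \<mu>] continuous_intros)
  have add: "second_kind \<mu> (r + s) x = second_kind \<mu> r x + second_kind \<mu> s x" for r s
    using int by (simp add: second_kind_def difference_quotient_add)
  have smult: "second_kind \<mu> (smult c r) x = of_real c * second_kind \<mu> r x" for r c
    using int by (simp add: second_kind_def difference_quotient_smult)
  have mean: "(LINT t|\<mu>. poly (p j) t) = (if j = 0 then 1 else 0)" for j
  proof -
    have "(LINT t|\<mu>. poly (p 0) t * poly (p j) t) = (if 0 = j then 1 else 0)"
      using p unfolding orthonormal_polys_def by blast
    then show ?thesis by (simp add: p0)
  qed
  have X: "second_kind \<mu> ([:0, 1:] * p j) x = (if j = 0 then 1 else 0) + x * second_kind \<mu> (p j) x" for j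
  proof -
    have "[:0, 1:] * p j = pCons 0 (p j)" by simp
    then have "second_kind \<mu> ([:0, 1:] * p j) x =
      (LINT t|\<mu>. complex_of_real (poly (p j) t) + x * difference_quotient (p j) x (complex_of_real t))"
      by (simp add: second_kind_def difference_quotient_pCons cpoly_of_real)
    also have "\<dots> = of_real (LINT t|\<mu>. poly (p j) t) + x * second_kind \<mu> (p j) x"
      using int intp by (simp add: second_kind_def)
    finally show ?thesis by (simp add: mean)
  qed
  show "jacobi_solution a b x 1 (\<lambda>j. second_kind \<mu> (p j) x)"
    unfolding jacobi_solution_def
  proof (intro conjI allI impI)
    show "x * second_kind \<mu> (p 0) x = of_real (a 1) * second_kind \<mu> (p 1) x +
        of_real (b 1) * second_kind \<mu> (p 0) x - 1"
      using X[of 0] unfolding jacobi_recurrence(1)[OF assms] add smult by (simp add: q0)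
    fix j :: nat assume "j \<ge> 1"
    then show "x * second_kind \<mu> (p j) x = of_real (a (j + 1)) * second_kind \<mu> (p (j + 1)) x +
        of_real (b (j + 1)) * second_kind \<mu> (p j) x + of_real (a j) * second_kind \<mu> (p (j - 1)) x"
      using X[of j] unfolding jacobi_recurrence(2)[OF assms \<open>j \<ge> 1\<close>] add smult by simp
  qed
qed

lemma first_kind_jacobi_solution:
  assumes \<mu>: "nontrivial_cpt_prob_measure \<mu>" and p: "orthonormal_polys \<mu> p"
    and ab: "jacobi_parameters \<mu> a b"
  shows "jacobi_solution a b x 0 (\<lambda>j. cpoly (p j) x)" and "cpoly (p 0) x = 1"
proof -
  have X: "cpoly ([:0, 1:] * r) x = x * cpoly r x" for r
  proof -
    have "[:0, 1:] * r = pCons 0 r" by simp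
    then show ?thesis by (simp only: cpoly_pCons) simp
  qed
  show "jacobi_solution a b x 0 (\<lambda>j. cpoly (p j) x)"
    unfolding jacobi_solution_def
  proof (intro conjI allI impI)
    show "x * cpoly (p 0) x = of_real (a 1) * cpoly (p 1) x + of_real (b 1) * cpoly (p 0) x - 0"
      unfolding X[symmetric] jacobi_recurrence(1)[OF assms] by (simp add: cpoly_add cpoly_smult)
    fix j :: nat assume "j \<ge> 1"
    then show "x * cpoly (p j) x = of_real (a (j + 1)) * cpoly (p (j + 1)) x +
        of_real (b (j + 1)) * cpoly (p j) x + of_real (a j) * cpoly (p (j - 1)) x"
      unfolding X[symmetric] jacobi_recurrence(2)[OF assms \<open>j \<ge> 1\<close>]
      by (simp add: cpoly_add cpoly_smult)
  qed
  show "cpoly (p 0) x = 1" by (simp add: orthonormal_poly_0[OF \<mu> p])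
qed

section \<open>The square summable solution and coefficient stripping\<close>

lemma bessel_inequality:
  fixes f :: "real \<Rightarrow> complex"
  assumes \<mu>: "nontrivial_cpt_prob_measure \<mu>" and p: "orthonormal_polys \<mu> p"
    and f: "continuous_on UNIV f"
  shows "(\<Sum>j<n. (cmod (LINT t|\<mu>. of_real (poly (p j) t) * f t))\<^sup>2) \<le> (LINT t|\<mu>. (cmod (f t))\<^sup>2)"
proof -
  define c where "c = (\<lambda>j. LINT t|\<mu>. of_real (poly (p j) t) * f t)"
  define s where "s = (\<lambda>t. \<Sum>j<n. c j * complex_of_real (poly (p j) t))"
  note cont = continuous_intros f continuous_on_compose2[OF f]
  have int: "integrable \<mu> g" if "continuous_on UNIV g" for g :: "real \<Rightarrow> complex"
    by (rule integrable_continuous[OF \<mu> that])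
  have conts: "continuous_on UNIV s" unfolding s_def by (intro continuous_intros)
  have fs: "(LINT t|\<mu>. f t * cnj (s t)) = (\<Sum>j<n. of_real ((cmod (c j))\<^sup>2))"
  proof -
    have "(LINT t|\<mu>. f t * cnj (s t)) = (LINT t|\<mu>. (\<Sum>j<n. cnj (c j) * (of_real (poly (p j) t) * f t)))"
      by (simp add: s_def sum_distrib_left mult_ac)
    also have "\<dots> = (\<Sum>j<n. (LINT t|\<mu>. cnj (c j) * (of_real (poly (p j) t) * f t)))"
      by (intro Bochner_Integration.integral_sum int cont)
    also have "\<dots> = (\<Sum>j<n. cnj (c j) * c j)" by (simp add: c_def)
    also have "\<dots> = (\<Sum>j<n. of_real ((cmod (c j))\<^sup>2))"
      by (simp only: complex_norm_square mult.commute)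
    finally show ?thesis .
  qed
  have sp: "(LINT t|\<mu>. s t * of_real (poly (p k) t)) = c k" if "k < n" for k
  proof -
    have "(LINT t|\<mu>. s t * of_real (poly (p k) t)) =
        (LINT t|\<mu>. (\<Sum>j<n. c j * (of_real (poly (p j) t) * of_real (poly (p k) t))))"
      by (simp add: s_def sum_distrib_right mult.assoc)
    also have "\<dots> = (\<Sum>j<n. (LINT t|\<mu>. c j * (of_real (poly (p j) t) * of_real (poly (p k) t))))"
      by (intro Bochner_Integration.integral_sum int cont)
    also have "\<dots> = (\<Sum>j<n. c j * of_real (LINT t|\<mu>. poly (p j) t * poly (p k) t))"
      by (simp flip: of_real_mult)
    also have "\<dots> = (\<Sum>j<n. if j = k then c k else 0)"
      using p unfolding orthonormal_polys_def by (intro sum.cong) auto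
    also have "\<dots> = c k" using that by simp
    finally show ?thesis .
  qed
  have ss: "(LINT t|\<mu>. s t * cnj (s t)) = (\<Sum>j<n. of_real ((cmod (c j))\<^sup>2))"
  proof -
    have "(LINT t|\<mu>. s t * cnj (s t)) = (LINT t|\<mu>. (\<Sum>j<n. cnj (c j) * (s t * of_real (poly (p j) t))))"
      by (subst (2) s_def) (simp add: sum_distrib_left mult_ac)
    also have "\<dots> = (\<Sum>j<n. (LINT t|\<mu>. cnj (c j) * (s t * of_real (poly (p j) t))))"
      by (intro Bochner_Integration.integral_sum int cont conts)
    also have "\<dots> = (\<Sum>j<n. cnj (c j) * c j)" by (simp add: sp)
    also have "\<dots> = (\<Sum>j<n. of_real ((cmod (c j))\<^sup>2))"
      by (simp only: complex_norm_square mult.commute)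
    finally show ?thesis .
  qed
  have sf: "(LINT t|\<mu>. s t * cnj (f t)) = (\<Sum>j<n. of_real ((cmod (c j))\<^sup>2))"
  proof -
    have "(LINT t|\<mu>. s t * cnj (f t)) = (LINT t|\<mu>. cnj (f t * cnj (s t)))"
      by (simp add: mult.commute)
    also have "\<dots> = cnj (LINT t|\<mu>. f t * cnj (s t))" by (rule Bochner_Integration.integral_cnj)
    finally show ?thesis by (simp add: fs)
  qed
  have "complex_of_real (LINT t|\<mu>. (cmod (f t - s t))\<^sup>2) =
      (LINT t|\<mu>. complex_of_real ((cmod (f t - s t))\<^sup>2))"
    by (rule integral_complex_of_real[symmetric])
  also have "\<dots> = (LINT t|\<mu>. f t * cnj (f t) - f t * cnj (s t) - s t * cnj (f t) + s t * cnj (s t))"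
    by (intro Bochner_Integration.integral_cong refl, simp only: complex_norm_square)
       (simp add: algebra_simps)
  also have "\<dots> = (LINT t|\<mu>. f t * cnj (f t)) - (LINT t|\<mu>. f t * cnj (s t))
      - (LINT t|\<mu>. s t * cnj (f t)) + (LINT t|\<mu>. s t * cnj (s t))"
    by (simp add: int cont conts)
  also have "(LINT t|\<mu>. f t * cnj (f t)) = of_real (LINT t|\<mu>. (cmod (f t))\<^sup>2)"
    by (simp only: complex_norm_square[symmetric] integral_complex_of_real)
  finally have "complex_of_real (LINT t|\<mu>. (cmod (f t - s t))\<^sup>2) =
      of_real ((LINT t|\<mu>. (cmod (f t))\<^sup>2) - (\<Sum>j<n. (cmod (c j))\<^sup>2))"
    unfolding fs sf ss by simp
  then have "(LINT t|\<mu>. (cmod (f t - s t))\<^sup>2) = (LINT t|\<mu>. (cmod (f t))\<^sup>2) - (\<Sum>j<n. (cmod (c j))\<^sup>2)"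
    using of_real_eq_iff by blast
  moreover have "(LINT t|\<mu>. (cmod (f t - s t))\<^sup>2) \<ge> 0" by simp
  ultimately show ?thesis by (simp add: c_def)
qed

lemma continuous_on_resolvent:
  assumes "Im z \<noteq> 0"
  shows "continuous_on UNIV (\<lambda>t. 1 / (complex_of_real t - z))"
  using assms by (intro continuous_intros) (auto simp: complex_eq_iff)

lemma integrable_resolvent:
  assumes "nontrivial_cpt_prob_measure \<mu>" "Im z \<noteq> 0"
  shows "integrable \<mu> (\<lambda>t. 1 / (complex_of_real t - z))"
  by (rule integrable_continuous[OF assms(1) continuous_on_resolvent[OF assms(2)]])

lemma Im_stieltjes_transform:
  assumes \<mu>: "nontrivial_cpt_prob_measure \<mu>" and z: "Im z \<noteq> 0"
  shows "Im (stieltjes_transform \<mu> z) = Im z * (LINT t|\<mu>. (cmod (1 / (complex_of_real t - z)))\<^sup>2)"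
proof -
  have "Im (stieltjes_transform \<mu> z) = (LINT t|\<mu>. Im (1 / (complex_of_real t - z)))"
    unfolding stieltjes_transform_def by (rule integral_Im[symmetric, OF integrable_resolvent[OF assms]])
  also have "\<dots> = (LINT t|\<mu>. Im z * (cmod (1 / (complex_of_real t - z)))\<^sup>2)"
    by (intro Bochner_Integration.integral_cong refl)
       (simp add: Im_divide norm_divide power_divide cmod_power2)
  finally show ?thesis by simp
qed

text \<open>
  This combination of the two polynomial solutions consists of the Fourier coefficients of
  \<open>t \<mapsto> 1 / (t - z)\<close> with respect to the \<open>p\<^sub>j\<close>, as the next lemma shows. That is why Bessel's
  inequality applies to it.
\<close>

definition weyl_solution :: "real measure \<Rightarrow> (nat \<Rightarrow> real poly) \<Rightarrow> complex \<Rightarrow> nat \<Rightarrow> complex" where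
  "weyl_solution \<mu> p z j = second_kind \<mu> (p j) z + stieltjes_transform \<mu> z * cpoly (p j) z"

lemma weyl_solution_integral:
  assumes \<mu>: "nontrivial_cpt_prob_measure \<mu>" and z: "Im z \<noteq> 0"
  shows "weyl_solution \<mu> p z j =
    (LINT t|\<mu>. of_real (poly (p j) t) * (1 / (complex_of_real t - z)))"
proof -
  have ne: "complex_of_real t \<noteq> z" for t using z by auto
  have "(LINT t|\<mu>. of_real (poly (p j) t) * (1 / (complex_of_real t - z))) =
      (LINT t|\<mu>. difference_quotient (p j) z (complex_of_real t) +
          cpoly (p j) z * (1 / (complex_of_real t - z)))"
  proof (intro Bochner_Integration.integral_cong refl)
    fix t
    show "of_real (poly (p j) t) * (1 / (complex_of_real t - z)) =
      difference_quotient (p j) z (complex_of_real t) + cpoly (p j) z * (1 / (complex_of_real t - z))"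
      using ne[of t] by (simp add: difference_quotient_def cpoly_of_real divide_simps)
        (simp add: algebra_simps)
  qed
  also have "\<dots> = second_kind \<mu> (p j) z + cpoly (p j) z * stieltjes_transform \<mu> z"
    unfolding second_kind_def stieltjes_transform_def
    by (subst Bochner_Integration.integral_add)
       (simp_all only: integrable_mult_right integral_mult_right_zero integrable_resolvent[OF assms]
         integrable_continuous[OF \<mu> continuous_on_difference_quotient])
  finally show ?thesis by (simp add: weyl_solution_def)
qed

lemma weyl_solution_sum_le:
  assumes \<mu>: "nontrivial_cpt_prob_measure \<mu>" and p: "orthonormal_polys \<mu> p" and z: "Im z \<noteq> 0"
  shows "(\<Sum>j<n. (cmod (weyl_solution \<mu> p z j))\<^sup>2) \<le> Im (stieltjes_transform \<mu> z) / Im z"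
  using bessel_inequality[OF \<mu> p continuous_on_resolvent[OF z], of n]
  by (simp add: weyl_solution_integral[OF \<mu> z] Im_stieltjes_transform[OF \<mu> z] z)

lemma weyl_solution_tendsto_0:
  assumes \<mu>: "nontrivial_cpt_prob_measure \<mu>" and p: "orthonormal_polys \<mu> p" and z: "Im z \<noteq> 0"
  shows "weyl_solution \<mu> p z \<longlonglongrightarrow> 0"
proof -
  have "summable (\<lambda>j. (cmod (weyl_solution \<mu> p z j))\<^sup>2)"
    by (intro summableI_nonneg_bounded[where x = "Im (stieltjes_transform \<mu> z) / Im z"]
        weyl_solution_sum_le[OF assms]) simp
  then have "(\<lambda>j. (cmod (weyl_solution \<mu> p z j))\<^sup>2) \<longlonglongrightarrow> 0" by (rule summable_LIMSEQ_zero)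
  then have "(\<lambda>j. sqrt ((cmod (weyl_solution \<mu> p z j))\<^sup>2)) \<longlonglongrightarrow> sqrt 0" by (rule tendsto_real_sqrt)
  then show ?thesis by (simp add: tendsto_norm_zero_iff)
qed

lemma weyl_solution_jacobi_solution:
  assumes "nontrivial_cpt_prob_measure \<mu>" "orthonormal_polys \<mu> p" "jacobi_parameters \<mu> a b"
  shows "jacobi_solution a b z 1 (weyl_solution \<mu> p z)"
    and "weyl_solution \<mu> p z 0 = stieltjes_transform \<mu> z"
  using jacobi_solution_add_mult[OF second_kind_jacobi_solution(1)[OF assms]
      first_kind_jacobi_solution(1)[OF assms], of z "stieltjes_transform \<mu> z"]
    second_kind_jacobi_solution(2)[OF assms] first_kind_jacobi_solution(2)[OF assms]
  by (simp_all add: weyl_solution_def[abs_def])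

text \<open>
  The square summable solution \<open>u'\<close> for \<open>\<mu>'\<close>, shifted by one index and started with \<open>- 1 / a 1\<close>, solves
  the recurrence of \<open>\<mu>\<close> from index 1 on. Its Wronskian with the square summable solution \<open>u\<close> for
  \<open>\<mu>\<close> is constant, and it tends to 0 because both solutions do and the \<open>a n\<close> are bounded. Evaluating
  it at index 1 gives the formula.
\<close>

lemma coefficient_stripping:
  assumes \<mu>: "nontrivial_cpt_prob_measure \<mu>" and ab: "jacobi_parameters \<mu> a b"
    and \<mu>': "nontrivial_cpt_prob_measure \<mu>'"
    and ab': "jacobi_parameters \<mu>' (\<lambda>n. a (n + 1)) (\<lambda>n. b (n + 1))"
    and z: "Im z \<noteq> 0"
  shows "(z - of_real (b 1)) * stieltjes_transform \<mu> z + 1 =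
    - (of_real ((a 1)\<^sup>2) * stieltjes_transform \<mu>' z * stieltjes_transform \<mu> z)"
proof -
  obtain p where p: "orthonormal_polys \<mu> p" using ab unfolding jacobi_parameters_def by blast
  obtain p' where p': "orthonormal_polys \<mu>' p'" using ab' unfolding jacobi_parameters_def by blast
  define F where "F = stieltjes_transform \<mu> z"
  define F' where "F' = stieltjes_transform \<mu>' z"
  define u where "u = weyl_solution \<mu> p z"
  define u' where "u' = weyl_solution \<mu>' p' z"
  have a1: "a 1 > 0" using ab unfolding jacobi_parameters_def by blast
  \<comment> \<open>The value at 0 is forced by the recurrence at \<open>j = 1\<close>, where the inhomogeneity 1 of \<open>u'\<close> must
    become \<open>- a 1 * v 0\<close>.\<close>
  define v where "v = (\<lambda>j. if j = 0 then - 1 / complex_of_real (a 1) else u' (j - 1))"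
  have u: "jacobi_solution a b z 1 u" and u0: "u 0 = F"
    using weyl_solution_jacobi_solution[OF \<mu> p ab, of z] by (simp_all add: u_def F_def)
  have u': "jacobi_solution (\<lambda>n. a (n + 1)) (\<lambda>n. b (n + 1)) z 1 u'" and u'0: "u' 0 = F'"
    using weyl_solution_jacobi_solution[OF \<mu>' p' ab', of z] by (simp_all add: u'_def F'_def)
  have v: "z * v j = of_real (a (j + 1)) * v (j + 1) + of_real (b (j + 1)) * v j + of_real (a j) * v (j - 1)"
    if "j \<ge> 1" for j
  proof (cases "j = 1")
    case True
    have "z * u' 0 = of_real (a 2) * u' 1 + of_real (b 2) * u' 0 - 1"
      using u' unfolding jacobi_solution_def by (simp add: numeral_2_eq_2)
    then show ?thesis using True a1 by (simp add: v_def numeral_2_eq_2)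
  next
    case False
    define i where "i = j - 1"
    have i: "j = i + 1" "i \<ge> 1" using False that by (auto simp: i_def)
    then show ?thesis using u' unfolding jacobi_solution_def v_def by auto
  qed
  have const: "wronskian a n u v = wronskian a 1 u v" if "n \<ge> 1" for n
    using that
  proof (induction n rule: dec_induct)
    case (step n)
    have "z * u n =
        of_real (a (n + 1)) * u (n + 1) + of_real (b (n + 1)) * u n + of_real (a n) * u (n - 1)"
      using u step(1) unfolding jacobi_solution_def by blast
    with v[OF step(1)] have "wronskian a (Suc n) u v = wronskian a n u v"
      unfolding wronskian_def by simp algebra
    then show ?case using step.IH by simp
  qed simp
  obtain R where R: "\<And>n. n \<ge> 1 \<Longrightarrow> \<bar>a n\<bar> \<le> R"
    using jacobi_parameters_bounded[OF \<mu> p ab] by blast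
  have tu: "u \<longlonglongrightarrow> 0" unfolding u_def by (rule weyl_solution_tendsto_0[OF \<mu> p z])
  have tu': "u' \<longlonglongrightarrow> 0" unfolding u'_def by (rule weyl_solution_tendsto_0[OF \<mu>' p' z])
  have "(\<lambda>n. wronskian a (n + 2) u v) \<longlonglongrightarrow> 0"
  proof (rule Lim_null_comparison)
    have "(\<lambda>n. u (n + 2) * u' n - u (n + 1) * u' (n + 1)) \<longlonglongrightarrow> 0 * 0 - 0 * 0"
      using tu tu' by (intro tendsto_intros LIMSEQ_ignore_initial_segment)
    from tendsto_mult_right[OF tendsto_norm[OF this], of R]
    show "(\<lambda>n. R * cmod (u (n + 2) * u' n - u (n + 1) * u' (n + 1))) \<longlonglongrightarrow> 0"
      by (simp add: mult.commute)
    show "\<forall>\<^sub>F n in sequentially. cmod (wronskian a (n + 2) u v) \<le>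
        R * cmod (u (n + 2) * u' n - u (n + 1) * u' (n + 1))"
    proof (rule always_eventually, rule allI)
      fix n
      have "cmod (wronskian a (n + 2) u v) =
          \<bar>a (n + 2)\<bar> * cmod (u (n + 2) * u' n - u (n + 1) * u' (n + 1))"
        by (simp add: wronskian_def norm_mult v_def numeral_2_eq_2)
      then show "cmod (wronskian a (n + 2) u v) \<le>
        R * cmod (u (n + 2) * u' n - u (n + 1) * u' (n + 1))"
        using R[of "n + 2"] by (simp add: mult_right_mono)
    qed
  qed
  moreover have "(\<lambda>n. wronskian a (n + 2) u v) = (\<lambda>n. wronskian a 1 u v)"
    by (intro ext const) simp
  ultimately have "wronskian a 1 u v = 0" by (simp only: LIMSEQ_const_iff)
  then have "u 1 * v 0 = u 0 * v 1" using a1 by (simp add: wronskian_def)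
  then have "- u 1 = of_real (a 1) * F * F'" using a1 by (simp add: v_def u0 u'0 field_simps)
  moreover have "z * F = of_real (a 1) * u 1 + of_real (b 1) * F - 1"
    using u u0 unfolding jacobi_solution_def by simp
  ultimately have "(z - of_real (b 1)) * F + 1 = - (of_real (a 1) * of_real (a 1) * F' * F)" by algebra
  then show ?thesis by (simp add: F_def F'_def power2_eq_square)
qed

section \<open>Normal families of entire functions\<close>

text \<open>
  On the circle \<open>|z| = R\<close> one has \<open>z\<^sup>2 - R\<^sup>2 = z (z - cnj z)\<close>, of modulus \<open>2 R |Im z|\<close>. Multiplication by
  this polynomial therefore compensates a blow-up like \<open>1 / |Im z|\<close> at the two real points of the
  circle, and the maximum principle applies.
\<close>

lemma entire_bound_of_real_axis_bound:
  assumes f: "f holomorphic_on UNIV" and R: "R > 0"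
    and le: "\<And>z. cmod z = R \<Longrightarrow> Im z \<noteq> 0 \<Longrightarrow> \<bar>Im z\<bar> * cmod (f z) \<le> C"
    and z: "cmod z \<le> R"
  shows "(R\<^sup>2 - (cmod z)\<^sup>2) * cmod (f z) \<le> 2 * R * C"
proof -
  define h where "h = (\<lambda>z. (z\<^sup>2 - of_real (R\<^sup>2)) * f z)"
  have hol: "h holomorphic_on UNIV" unfolding h_def by (intro holomorphic_intros f)
  have C: "C \<ge> 0"
  proof -
    have "\<bar>Im (\<i> * of_real R)\<bar> * cmod (f (\<i> * of_real R)) \<le> C"
      using R by (intro le) (auto simp: norm_mult)
    then show ?thesis by (rule order_trans[rotated]) simp
  qed
  have bd: "cmod (h w) \<le> 2 * R * C" if "w \<in> frontier (ball 0 R)" for w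
  proof -
    have w: "cmod w = R" using that R by (simp add: dist_norm)
    have "w\<^sup>2 - of_real (R\<^sup>2) = w * (w - cnj w)"
      by (simp only: complex_norm_square flip: w) (simp add: power2_eq_square algebra_simps)
    also have "w - cnj w = 2 * \<i> * of_real (Im w)" by (simp add: complex_eq_iff)
    finally have "cmod (h w) = 2 * R * (\<bar>Im w\<bar> * cmod (f w))"
      by (simp add: h_def norm_mult w)
    moreover have "\<bar>Im w\<bar> * cmod (f w) \<le> C" using le[OF w] C by (cases "Im w = 0") auto
    ultimately show ?thesis using R by simp
  qed
  have "cmod (h z) \<le> 2 * R * C"
  proof (rule maximum_modulus_frontier[where f = h and S = "cball 0 R"])
    show "h holomorphic_on interior (cball 0 R)" by (rule holomorphic_on_subset[OF hol]) simp
    show "continuous_on (closure (cball 0 R)) h"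
      by (rule holomorphic_on_imp_continuous_on[OF holomorphic_on_subset[OF hol]]) simp
    show "cmod (h w) \<le> 2 * R * C" if "w \<in> frontier (cball 0 R)" for w
      using bd that R by simp
  qed (use z in auto)
  moreover have "R\<^sup>2 - (cmod z)\<^sup>2 \<le> cmod (z\<^sup>2 - of_real (R\<^sup>2))"
    using norm_triangle_ineq2[of "complex_of_real (R\<^sup>2)" "z\<^sup>2"] R
    by (simp add: norm_power norm_minus_commute)
  then have "(R\<^sup>2 - (cmod z)\<^sup>2) * cmod (f z) \<le> cmod (h z)"
    unfolding h_def norm_mult by (intro mult_right_mono) auto
  ultimately show ?thesis by linarith
qed

text \<open>
  Montel's theorem in the form used twice below: a locally bounded sequence all of whose subsequential
  limits agree converges. If it did not, Montel's theorem would give a convergent subsequence staying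
  away from the common limit.
\<close>

lemma Vitali_uniform_limit:
  fixes f :: "nat \<Rightarrow> complex \<Rightarrow> complex"
  assumes S: "open S" and hol: "\<And>n. f n holomorphic_on S"
    and bdd: "\<And>K. compact K \<Longrightarrow> K \<subseteq> S \<Longrightarrow> \<exists>B. \<forall>\<^sub>F n in sequentially. \<forall>z\<in>K. cmod (f n z) \<le> B"
    and unique: "\<And>g r. g holomorphic_on S \<Longrightarrow> strict_mono (r :: nat \<Rightarrow> nat) \<Longrightarrow>
        (\<And>z. z \<in> S \<Longrightarrow> (\<lambda>n. f (r n) z) \<longlonglongrightarrow> g z) \<Longrightarrow> (\<And>z. z \<in> S \<Longrightarrow> g z = h z)"
    and K: "compact K" "K \<subseteq> S"
  shows "uniform_limit K f h sequentially"
proof (rule ccontr)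
  assume "\<not> uniform_limit K f h sequentially"
  then obtain e where e: "e > 0" and "\<not> (\<forall>\<^sub>F n in sequentially. \<forall>z\<in>K. dist (f n z) (h z) < e)"
    unfolding uniform_limit_iff by blast
  then obtain r :: "nat \<Rightarrow> nat" where r: "strict_mono r" "\<And>n. \<not> (\<forall>z\<in>K. dist (f (r n) z) (h z) < e)"
    using not_eventually_sequentiallyD by blast
  have bd: "\<exists>B. \<forall>k\<in>range (\<lambda>n. f (r n)). \<forall>z\<in>K'. cmod (k z) \<le> B" if K': "compact K'" "K' \<subseteq> S" for K'
  proof -
    obtain B N where B: "\<And>n z. n \<ge> N \<Longrightarrow> z \<in> K' \<Longrightarrow> cmod (f n z) \<le> B"
      using bdd[OF K'] unfolding eventually_sequentially by blast
    have "\<exists>B. \<forall>z\<in>K'. cmod (f n z) \<le> B" for n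
    proof -
      have "continuous_on K' (f n)"
        by (rule holomorphic_on_imp_continuous_on[OF holomorphic_on_subset[OF hol K'(2)]])
      then have "bounded (f n ` K')"
        by (rule compact_imp_bounded[OF compact_continuous_image[OF _ K'(1)]])
      then show ?thesis unfolding bounded_iff by blast
    qed
    then obtain B' where B': "\<And>n z. z \<in> K' \<Longrightarrow> cmod (f n z) \<le> B' n" by metis
    have "cmod (f n z) \<le> Max (insert B (B' ` {..<N}))" if "z \<in> K'" for n z
    proof (cases "n < N")
      case True
      then have "B' n \<le> Max (insert B (B' ` {..<N}))" by (intro Max_ge) auto
      then show ?thesis using B'[OF that, of n] by linarith
    next
      case False
      have "B \<le> Max (insert B (B' ` {..<N}))" by (intro Max_ge) auto
      then show ?thesis using order_trans[OF B[of n z]] that False by auto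
    qed
    then show ?thesis by (intro exI[of _ "Max (insert B (B' ` {..<N}))"]) auto
  qed
  obtain g r' where g: "g holomorphic_on S" "strict_mono (r' :: nat \<Rightarrow> nat)"
    "\<And>z. z \<in> S \<Longrightarrow> (\<lambda>n. f (r (r' n)) z) \<longlonglongrightarrow> g z"
    "\<And>K'. compact K' \<Longrightarrow> K' \<subseteq> S \<Longrightarrow> uniform_limit K' ((\<lambda>n. f (r n)) \<circ> r') g sequentially"
  proof (rule Montel[where \<F> = "\<lambda>n. f (r n)" and \<H> = "range (\<lambda>n. f (r n))", OF S _ bd])
    show "k holomorphic_on S" if "k \<in> range (\<lambda>n. f (r n))" for k using that hol by blast
  qed auto
  have gh: "g z = h z" if "z \<in> S" for z
  proof (rule unique[of g "r \<circ> r'", OF g(1) _ _ that])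
    show "strict_mono (r \<circ> r')" using r(1) g(2) by (rule strict_mono_o)
    show "(\<lambda>n. f ((r \<circ> r') n) z) \<longlonglongrightarrow> g z" if "z \<in> S" for z using g(3)[OF that] by simp
  qed
  have "\<forall>\<^sub>F n in sequentially. \<forall>z\<in>K. dist (((\<lambda>n. f (r n)) \<circ> r') n z) (g z) < e"
    using g(4)[OF K] e unfolding uniform_limit_iff by blast
  then obtain n where n: "\<forall>z\<in>K. dist (f (r (r' n)) z) (g z) < e"
    by (auto simp: eventually_sequentially)
  have "dist (f (r (r' n)) z) (h z) < e" if "z \<in> K" for z
    using n[rule_format, OF that] gh[OF subsetD[OF K(2) that]] by simp
  then show False using r(2)[of "r' n"] by blast
qed

section \<open>The Stieltjes transform near a boundary point\<close>

text \<open>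
  A Harnack type inequality: \<open>|t - z'|\<close> is at most \<open>|t - z|\<close> times a factor independent of \<open>t\<close>, so the
  integrand \<open>(z - z') / ((t - z) (t - z'))\<close> of the difference is dominated by a multiple of
  \<open>1 / |t - z'|\<^sup>2\<close>, whose integral is \<open>Im F(z') / Im z'\<close>.
\<close>

lemma norm_stieltjes_transform_diff_le:
  assumes \<mu>: "nontrivial_cpt_prob_measure \<mu>" and z: "Im z > 0" and z': "Im z' > 0"
  shows "cmod (stieltjes_transform \<mu> z - stieltjes_transform \<mu> z') \<le>
    cmod (z - z') * (1 + cmod (z - z') / Im z) * (Im (stieltjes_transform \<mu> z') / Im z')"
proof -
  define C where "C = cmod (z - z') * (1 + cmod (z - z') / Im z)"
  have ne: "complex_of_real t - z \<noteq> 0" "complex_of_real t - z' \<noteq> 0" for t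
    using z z' by (auto simp: complex_eq_iff)
  have int: "integrable \<mu> (\<lambda>t. (z - z') / ((complex_of_real t - z) * (complex_of_real t - z')))"
    by (intro integrable_continuous[OF \<mu>] continuous_intros) (use ne in auto)
  have int': "integrable \<mu> (\<lambda>t. C * (cmod (1 / (complex_of_real t - z')))\<^sup>2)"
    by (intro integrable_continuous[OF \<mu>] continuous_intros) (use ne in auto)
  have "stieltjes_transform \<mu> z - stieltjes_transform \<mu> z' =
      (LINT t|\<mu>. 1 / (complex_of_real t - z) - 1 / (complex_of_real t - z'))"
    unfolding stieltjes_transform_def using z z'
    by (subst Bochner_Integration.integral_diff) (auto intro!: integrable_resolvent[OF \<mu>])
  also have "\<dots> = (LINT t|\<mu>. (z - z') / ((complex_of_real t - z) * (complex_of_real t - z')))"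
    using ne by (intro Bochner_Integration.integral_cong refl) (simp add: field_simps)
  also have "cmod \<dots> \<le> (LINT t|\<mu>. C * (cmod (1 / (complex_of_real t - z')))\<^sup>2)"
  proof (rule Bochner_Integration.integral_norm_bound_integral[OF int int'])
    fix t
    have "Im z \<le> cmod (complex_of_real t - z)"
      using abs_Im_le_cmod[of "complex_of_real t - z"] by simp
    then have "cmod (z - z') * Im z \<le> cmod (z - z') * cmod (complex_of_real t - z)"
      by (intro mult_left_mono) auto
    then have "cmod (z - z') \<le> cmod (z - z') / Im z * cmod (complex_of_real t - z)"
      using z by (simp add: field_simps)
    moreover have "cmod (complex_of_real t - z') \<le> cmod (complex_of_real t - z) + cmod (z - z')"
      using norm_triangle_ineq[of "complex_of_real t - z" "z - z'"] by simp
    ultimately have "cmod (complex_of_real t - z') \<le>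
        (1 + cmod (z - z') / Im z) * cmod (complex_of_real t - z)"
      by (simp add: distrib_right)
    then have le: "cmod (z - z') * cmod (complex_of_real t - z') \<le> C * cmod (complex_of_real t - z)"
      unfolding C_def mult.assoc by (intro mult_left_mono) auto
    have pos: "cmod (complex_of_real t - z) > 0" "cmod (complex_of_real t - z') > 0"
      using ne[of t] by auto
    show "cmod ((z - z') / ((complex_of_real t - z) * (complex_of_real t - z')))
        \<le> C * (cmod (1 / (complex_of_real t - z')))\<^sup>2"
      using le pos by (simp add: norm_divide norm_mult divide_simps power2_eq_square mult_ac)
  qed
  also have "\<dots> = C * (Im (stieltjes_transform \<mu> z') / Im z')"
    using z' by (simp add: Im_stieltjes_transform[OF \<mu>])
  finally show ?thesis unfolding C_def .
qed

lemma holomorphic_on_stieltjes_transform: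
  assumes \<mu>: "nontrivial_cpt_prob_measure \<mu>"
  shows "stieltjes_transform \<mu> holomorphic_on {z. Im z > 0}"
proof (rule holomorphic_onI)
  fix z0 assume "z0 \<in> {z. Im z > 0}"
  then have z0: "Im z0 > 0" by simp
  interpret prob_space \<mu> using \<mu> unfolding nontrivial_cpt_prob_measure_def by blast
  define D where "D = (LINT t|\<mu>. 1 / (complex_of_real t - z0)\<^sup>2)"
  have bound: "cmod ((stieltjes_transform \<mu> z - stieltjes_transform \<mu> z0) / (z - z0) - D) \<le>
      cmod (z - z0) / (Im z0 / 2 * (Im z0)\<^sup>2)"
    if "z \<noteq> z0" "Im z > Im z0 / 2" for z
  proof -
    have z: "Im z > 0" using that z0 by linarith
    have ne: "complex_of_real t - z \<noteq> 0" "complex_of_real t - z0 \<noteq> 0" for t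
      using z z0 by (auto simp: complex_eq_iff)
    have intD: "integrable \<mu> (\<lambda>t. 1 / (complex_of_real t - z0)\<^sup>2)"
      by (intro integrable_continuous[OF \<mu>] continuous_intros) (use ne in auto)
    have int: "integrable \<mu> (\<lambda>t. (z - z0) / ((complex_of_real t - z) * (complex_of_real t - z0)\<^sup>2))"
      by (intro integrable_continuous[OF \<mu>] continuous_intros) (use ne in auto)
    have "(stieltjes_transform \<mu> z - stieltjes_transform \<mu> z0) / (z - z0) - D =
      (LINT t|\<mu>. (1 / (complex_of_real t - z) - 1 / (complex_of_real t - z0)) / (z - z0) -
        1 / (complex_of_real t - z0)\<^sup>2)"
      unfolding stieltjes_transform_def D_def using z z0 intD
        integrable_resolvent[OF \<mu>, of z] integrable_resolvent[OF \<mu>, of z0] by simp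
    also have "\<dots> = (LINT t|\<mu>. (z - z0) / ((complex_of_real t - z) * (complex_of_real t - z0)\<^sup>2))"
    proof (intro Bochner_Integration.integral_cong refl)
      fix t
      have "z - z0 \<noteq> 0" using that by simp
      then show "(1 / (complex_of_real t - z) - 1 / (complex_of_real t - z0)) / (z - z0) -
        1 / (complex_of_real t - z0)\<^sup>2 = (z - z0) / ((complex_of_real t - z) * (complex_of_real t - z0)\<^sup>2)"
        using ne[of t] by (simp add: divide_simps power2_eq_square)
    qed
    also have "cmod \<dots> \<le> (LINT t|\<mu>. cmod (z - z0) / (Im z0 / 2 * (Im z0)\<^sup>2))"
    proof (rule Bochner_Integration.integral_norm_bound_integral[OF int])
      fix t
      have "Im z0 / 2 \<le> cmod (complex_of_real t - z)"
        using abs_Im_le_cmod[of "complex_of_real t - z"] that by simp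
      moreover have "Im z0 \<le> cmod (complex_of_real t - z0)"
        using abs_Im_le_cmod[of "complex_of_real t - z0"] by simp
      ultimately have "Im z0 / 2 * (Im z0)\<^sup>2 \<le>
          cmod (complex_of_real t - z) * (cmod (complex_of_real t - z0))\<^sup>2"
        using z0 by (intro mult_mono power_mono) auto
      then show "cmod ((z - z0) / ((complex_of_real t - z) * (complex_of_real t - z0)\<^sup>2)) \<le>
          cmod (z - z0) / (Im z0 / 2 * (Im z0)\<^sup>2)"
        unfolding norm_divide norm_mult norm_power using z0 by (intro frac_le) auto
    qed simp
    also have "\<dots> = cmod (z - z0) / (Im z0 / 2 * (Im z0)\<^sup>2)" by (simp add: prob_space)
    finally show ?thesis .
  qed
  have "((\<lambda>z. (stieltjes_transform \<mu> z - stieltjes_transform \<mu> z0) / (z - z0) - D) \<longlongrightarrow> 0) (at z0)"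
  proof (rule Lim_null_comparison)
    have "open {z. Im z > Im z0 / 2}" by (rule open_halfspace_Im_gt)
    then have "\<forall>\<^sub>F z in at z0. z \<in> {z. Im z > Im z0 / 2}"
      using z0 by (intro eventually_at_topological[THEN iffD2]) auto
    moreover have "\<forall>\<^sub>F z in at z0. z \<noteq> z0" by (rule eventually_neq_at_within)
    ultimately show "\<forall>\<^sub>F z in at z0. cmod ((stieltjes_transform \<mu> z - stieltjes_transform \<mu> z0) / (z - z0) - D) \<le>
      cmod (z - z0) / (Im z0 / 2 * (Im z0)\<^sup>2)"
      by eventually_elim (use bound in auto)
    have "((\<lambda>z. cmod (z - z0) / (Im z0 / 2 * (Im z0)\<^sup>2)) \<longlongrightarrow> cmod (z0 - z0) / (Im z0 / 2 * (Im z0)\<^sup>2)) (at z0)"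
      using z0 by (intro tendsto_intros) auto
    then show "((\<lambda>z. cmod (z - z0) / (Im z0 / 2 * (Im z0)\<^sup>2)) \<longlongrightarrow> 0) (at z0)" by simp
  qed
  then have "(stieltjes_transform \<mu> has_field_derivative D) (at z0)"
    unfolding has_field_derivative_iff by (simp add: LIM_zero_iff)
  then show "stieltjes_transform \<mu> field_differentiable at z0 within {z. 0 < Im z}"
    using field_differentiable_at_within field_differentiable_def by blast
qed

text \<open>
  Only the limit along the vertical ray through \<open>x0\<close> is given. Comparison with the point
  \<open>x0 + \<i> / n\<close> bounds the rescaled functions locally uniformly in the upper half plane. A
  subsequential limit equals \<open>L\<close> on the imaginary half axis, hence everywhere. The explicit shape of
  the bound matters later: times \<open>Im a\<close> it stays bounded on bounded sets.
\<close>

lemma stieltjes_transform_rescaled: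
  assumes \<mu>: "nontrivial_cpt_prob_measure \<mu>"
    and L: "((\<lambda>\<epsilon>. stieltjes_transform \<mu> (Complex x0 \<epsilon>)) \<longlongrightarrow> L) (at_right 0)"
  shows stieltjes_transform_rescaled_bound:
      "\<exists>M\<ge>0. \<forall>\<^sub>F n in sequentially. \<forall>a. Im a > 0 \<longrightarrow>
        cmod (stieltjes_transform \<mu> (of_real x0 + a / of_nat n)) \<le>
        M * (1 + cmod (a - \<i>) * (1 + cmod (a - \<i>) / Im a))"
    and stieltjes_transform_rescaled_limit:
      "\<And>a. Im a > 0 \<Longrightarrow> (\<lambda>n. stieltjes_transform \<mu> (of_real x0 + a / of_nat n)) \<longlonglongrightarrow> L"
proof -
  define Fn where "Fn = (\<lambda>n a. stieltjes_transform \<mu> (of_real x0 + a / of_nat n))"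
  have vertical: "(\<lambda>n. Fn n (\<i> * of_real y)) \<longlonglongrightarrow> L" if "y > 0" for y
  proof -
    have "(\<lambda>n. y / real n) \<longlonglongrightarrow> 0" by real_asymp
    moreover have "\<forall>\<^sub>F n in sequentially. y / real n \<in> {0<..} \<and> y / real n \<noteq> 0"
      using eventually_gt_at_top[of 0] by eventually_elim (use that in auto)
    ultimately have "filterlim (\<lambda>n. y / real n) (at_right 0) sequentially"
      by (auto simp: filterlim_at elim: eventually_mono)
    from filterlim_compose[OF L this]
    have "(\<lambda>n. stieltjes_transform \<mu> (Complex x0 (y / real n))) \<longlonglongrightarrow> L" .
    moreover have "Complex x0 (y / real n) = of_real x0 + \<i> * of_real y / of_nat n" for n
      by (simp add: complex_eq_iff)
    ultimately show ?thesis by (simp add: Fn_def)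
  qed
  define M where "M = cmod L + 1"
  have M: "M > 0" by (simp add: M_def add_nonneg_pos)
  have ev: "\<forall>\<^sub>F n in sequentially. \<forall>a. Im a > 0 \<longrightarrow>
      cmod (Fn n a) \<le> M * (1 + cmod (a - \<i>) * (1 + cmod (a - \<i>) / Im a))"
  proof -
    have "(\<lambda>n. cmod (Fn n (\<i> * of_real 1))) \<longlonglongrightarrow> cmod L" using vertical[of 1] by (intro tendsto_norm) simp
    then have "\<forall>\<^sub>F n in sequentially. cmod (Fn n \<i>) < M"
      by (intro order_tendstoD(2)) (auto simp: M_def)
    then show ?thesis using eventually_gt_at_top[of 0]
    proof eventually_elim
      case (elim n)
      show ?case
      proof (intro allI impI)
        fix a assume a: "Im a > 0"
        define c where "c = cmod (a - \<i>) * (1 + cmod (a - \<i>) / Im a)"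
        have c: "c \<ge> 0" using a by (simp add: c_def)
        have n: "real n > 0" using elim by simp
        have "cmod (Fn n a - Fn n \<i>) \<le> cmod (a / n - \<i> / n) * (1 + cmod (a / n - \<i> / n) / (Im a / n)) *
            (Im (Fn n \<i>) / (1 / n))"
          using norm_stieltjes_transform_diff_le[OF \<mu>, of "of_real x0 + a / n" "of_real x0 + \<i> / n"] n a
          by (simp add: Fn_def)
        also have "a / n - \<i> / n = (a - \<i>) / n" by (simp add: diff_divide_distrib)
        also have "cmod ((a - \<i>) / n) = cmod (a - \<i>) / n" using n by (simp add: norm_divide)
        also have "cmod (a - \<i>) / n * (1 + cmod (a - \<i>) / n / (Im a / n)) * (Im (Fn n \<i>) / (1 / n)) =
            c * Im (Fn n \<i>)" using n by (simp add: c_def field_simps)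
        also have "\<dots> \<le> c * M"
        proof (rule mult_left_mono[OF _ c])
          show "Im (Fn n \<i>) \<le> M" using abs_Im_le_cmod[of "Fn n \<i>"] elim by linarith
        qed
        finally have "cmod (Fn n a - Fn n \<i>) \<le> c * M" .
        then have "cmod (Fn n a) \<le> M + c * M"
          using norm_triangle_ineq2[of "Fn n a" "Fn n \<i>"] elim by linarith
        then show "cmod (Fn n a) \<le> M * (1 + cmod (a - \<i>) * (1 + cmod (a - \<i>) / Im a))"
          by (simp add: c_def algebra_simps)
      qed
    qed
  qed
  then show "\<exists>M\<ge>0. \<forall>\<^sub>F n in sequentially. \<forall>a. Im a > 0 \<longrightarrow>
        cmod (stieltjes_transform \<mu> (of_real x0 + a / of_nat n)) \<le>
        M * (1 + cmod (a - \<i>) * (1 + cmod (a - \<i>) / Im a))"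
    using M unfolding Fn_def by (intro exI[of _ M]) auto
  define S where "S = {z. Im z > 0}"
  have S: "open S" "connected S"
    unfolding S_def by (auto intro: open_halfspace_Im_gt convex_connected convex_halfspace_Im_gt)
  have lim: "uniform_limit K Fn (\<lambda>_. L) sequentially" if K: "compact K" "K \<subseteq> S" for K
  proof (rule Vitali_uniform_limit[OF S(1) _ _ _ K])
    show "Fn n holomorphic_on S" for n
    proof (cases "n = 0")
      case True
      then show ?thesis by (simp add: Fn_def[abs_def])
    next
      case False
      have "(stieltjes_transform \<mu> \<circ> (\<lambda>a. of_real x0 + a / of_nat n)) holomorphic_on S"
      proof (rule holomorphic_on_compose_gen[OF _ holomorphic_on_stieltjes_transform[OF \<mu>]])
        show "(\<lambda>a. of_real x0 + a / of_nat n) holomorphic_on S"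
          using False by (intro holomorphic_intros) auto
        show "(\<lambda>a. of_real x0 + a / of_nat n) ` S \<subseteq> {z. 0 < Im z}"
          using False by (auto simp: S_def)
      qed
      then show ?thesis by (simp add: Fn_def[abs_def] o_def)
    qed
    show "\<exists>B. \<forall>\<^sub>F n in sequentially. \<forall>z\<in>K'. cmod (Fn n z) \<le> B"
      if K': "compact K'" "K' \<subseteq> S" for K'
    proof -
      have "compact ((\<lambda>a. M * (1 + cmod (a - \<i>) * (1 + cmod (a - \<i>) / Im a))) ` K')"
        using K' by (intro compact_continuous_image continuous_intros) (auto simp: S_def)
      then have "bounded ((\<lambda>a. M * (1 + cmod (a - \<i>) * (1 + cmod (a - \<i>) / Im a))) ` K')"
        by (rule compact_imp_bounded)
      then obtain B where B: "\<forall>a\<in>K'. \<bar>M * (1 + cmod (a - \<i>) * (1 + cmod (a - \<i>) / Im a))\<bar> \<le> B"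
        unfolding bounded_iff by auto
      show ?thesis
        using ev
      proof (intro exI[of _ B], eventually_elim)
        case (elim n)
        show ?case
        proof
          fix z assume z: "z \<in> K'"
          then have "Im z > 0" using K' by (auto simp: S_def)
          with elim have "cmod (Fn n z) \<le> M * (1 + cmod (z - \<i>) * (1 + cmod (z - \<i>) / Im z))" by blast
          with B z show "cmod (Fn n z) \<le> B" by fastforce
        qed
      qed
    qed
    fix g r z assume g: "g holomorphic_on S" and r: "strict_mono (r :: nat \<Rightarrow> nat)"
      and lim: "\<And>z. z \<in> S \<Longrightarrow> (\<lambda>n. Fn (r n) z) \<longlonglongrightarrow> g z" and z: "z \<in> S"
    have gL: "g (\<i> * of_real y) = L" if "y > 0" for y
    proof (rule LIMSEQ_unique)
      show "(\<lambda>n. Fn (r n) (\<i> * of_real y)) \<longlonglongrightarrow> g (\<i> * of_real y)"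
        using that by (intro lim) (simp add: S_def)
      show "(\<lambda>n. Fn (r n) (\<i> * of_real y)) \<longlonglongrightarrow> L"
        using LIMSEQ_subseq_LIMSEQ[OF vertical[OF that] r] by (simp add: o_def)
    qed
    have "g z - L = 0"
    proof (rule analytic_continuation[where f = "\<lambda>z. g z - L" and S = S
          and U = "(\<lambda>y. \<i> * of_real y) ` {0<..}" and \<xi> = \<i>])
      show "(\<lambda>z. g z - L) holomorphic_on S" by (intro holomorphic_intros g)
      show "(\<lambda>y. \<i> * complex_of_real y) ` {0<..} \<subseteq> S" by (auto simp: S_def)
      show "\<i> \<in> S" by (simp add: S_def)
      show "\<i> islimpt (\<lambda>y. \<i> * complex_of_real y) ` {0<..}"
      proof (rule islimptI)
        fix T assume T: "\<i> \<in> T" "open T"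
        then obtain e where e: "e > 0" "ball \<i> e \<subseteq> T" using openE by blast
        have "cmod (\<i> - \<i> * of_real (1 + e / 2)) = e / 2"
        proof -
          have "\<i> - \<i> * of_real (1 + e / 2) = - \<i> * of_real (e / 2)" by (simp add: algebra_simps)
          then show ?thesis using e by (simp add: norm_mult)
        qed
        then have "\<i> * of_real (1 + e / 2) \<in> ball \<i> e" using e by (simp add: dist_norm)
        moreover have "\<i> * of_real (1 + e / 2) \<noteq> \<i>" using e by (simp add: complex_eq_iff)
        ultimately show "\<exists>y\<in>(\<lambda>y. \<i> * complex_of_real y) ` {0<..}. y \<in> T \<and> y \<noteq> \<i>"
          using e by (intro bexI[of _ "\<i> * of_real (1 + e / 2)"] image_eqI[of _ _ "1 + e / 2"]) auto
      qed
    qed (use S z gL in auto)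
    then show "g z = L" by simp
  qed
  show "(\<lambda>n. stieltjes_transform \<mu> (of_real x0 + a / of_nat n)) \<longlonglongrightarrow> L" if "Im a > 0" for a
  proof -
    have "uniform_limit {a} Fn (\<lambda>_. L) sequentially" using that by (intro lim) (auto simp: S_def)
    then have "(\<lambda>n. Fn n a) \<longlonglongrightarrow> L" by (rule tendsto_uniform_limitI) simp
    then show ?thesis by (simp add: Fn_def)
  qed
qed

section \<open>The sine kernel\<close>

lemma le_sinh:
  fixes x :: real
  assumes "x \<ge> 0"
  shows "x \<le> sinh x"
proof -
  have "sinh 0 - 0 \<le> sinh x - x"
  proof (rule DERIV_nonneg_imp_nondecreasing[OF assms])
    fix y :: real
    have "((\<lambda>x. sinh x - x) has_real_derivative (cosh y - 1)) (at y)"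
      by (auto intro!: derivative_eq_intros)
    then show "\<exists>D. ((\<lambda>x. sinh x - x) has_real_derivative D) (at y) \<and> D \<ge> 0"
      using cosh_real_ge_1[of y] by auto
  qed
  then show ?thesis by simp
qed

lemma sin_i_times_of_real: "sin (\<i> * of_real y) = \<i> * of_real (sinh y)"
  by (simp add: sin_i_times sinh_field_def exp_minus exp_of_real)

lemma sin_quotient_mult: "(a - b) * sin_quotient c (b - a) = - sin (of_real c * (b - a))"
proof (cases "a = b")
  case False
  then have "b - a \<noteq> 0" by simp
  then show ?thesis unfolding sin_quotient_def by (simp add: field_simps)
qed simp

lemma sin_quotient_holomorphic: "sin_quotient c holomorphic_on UNIV"
proof (rule no_isolated_singularity'[where K = "{0}"])
  have "((\<lambda>z. sin (of_real c * z)) has_field_derivative of_real c) (at (0 :: complex))"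
    by (auto intro!: derivative_eq_intros)
  then have "((\<lambda>z. sin (of_real c * z) / z) \<longlongrightarrow> of_real c) (at (0 :: complex))"
    by (simp add: has_field_derivative_iff)
  moreover have "\<forall>\<^sub>F z in at 0. sin (of_real c * z) / z = sin_quotient c z"
    using eventually_neq_at_within[of 0 0 UNIV] by eventually_elim (simp add: sin_quotient_def)
  ultimately have "(sin_quotient c \<longlongrightarrow> of_real c) (at 0)" by (rule Lim_transform_eventually)
  then show "(sin_quotient c \<longlongrightarrow> sin_quotient c z) (at z within UNIV)" if "z \<in> {0}" for z
    using that by (simp add: sin_quotient_def)
  have "(\<lambda>z. sin (of_real c * z) / z) holomorphic_on UNIV - {0 :: complex}"
    by (intro holomorphic_intros) auto
  then show "sin_quotient c holomorphic_on UNIV - {0}"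
    by (rule holomorphic_transform) (simp add: sin_quotient_def)
qed auto

text \<open>
  This keeps \<open>K\<^sub>n(a, cnj a) / n\<close> away from 0 uniformly in \<open>a\<close> for large \<open>n\<close>, up to the real
  axis, when \<open>a\<close> is confined to a bounded part of the upper half plane.
\<close>

lemma sin_quotient_imaginary_ge:
  assumes "c > 0" "y > 0"
  shows "cmod (sin_quotient c (- 2 * \<i> * of_real y)) \<ge> c"
proof -
  have "of_real c * (- 2 * \<i> * of_real y) = - (\<i> * of_real (2 * c * y))" by (simp add: algebra_simps)
  then have "sin (of_real c * (- 2 * \<i> * of_real y)) = - (\<i> * of_real (sinh (2 * c * y)))"
    by (simp only: sin_minus sin_i_times_of_real)
  then have "cmod (sin_quotient c (- 2 * \<i> * of_real y)) = sinh (2 * c * y) / (2 * y)"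
    using assms by (simp add: sin_quotient_def norm_divide norm_mult)
  also have "\<dots> \<ge> 2 * c * y / (2 * y)"
    using assms le_sinh[of "2 * c * y"] by (intro divide_right_mono) auto
  finally show ?thesis using assms by simp
qed

section \<open>Convergence of the Weyl discs\<close>

text \<open>
  Put \<open>Y = \<tau> Im a\<close>. Since \<open>cos (\<i> Y) + \<i> sin (\<i> Y) = exp (- Y)\<close>, the disc condition forces
  \<open>|g a - (\<Lambda> - \<i>)| \<le> 2 / sinh Y \<le> 2 / Y\<close>. Together with the reflection symmetry, \<open>|Im a| |g a|\<close> grows at
  most linearly in \<open>|a|\<close>, which is enough for \<open>g\<close> to be bounded. So \<open>g\<close> is a constant, equal to its
  limit \<open>\<Lambda> - \<i>\<close> along the imaginary axis, and the symmetry makes this number real.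
\<close>

lemma weyl_disc_rigidity:
  assumes g: "g holomorphic_on UNIV" and real: "\<And>a. g (cnj a) = cnj (g a)" and \<tau>: "\<tau> > 0"
    and disc: "\<And>a. Im a > 0 \<Longrightarrow>
      cmod ((g a - \<Lambda>) * sin (\<i> * of_real (\<tau> * Im a)) - cos (\<i> * of_real (\<tau> * Im a))) \<le> 1"
  shows "Im \<Lambda> = 1" and "g a = of_real (Re \<Lambda>)"
proof -
  have near: "cmod (g a - (\<Lambda> - \<i>)) \<le> 2 / (\<tau> * Im a)" if a: "Im a > 0" for a
  proof -
    define Y where "Y = \<tau> * Im a"
    have Y: "Y > 0" using a \<tau> by (simp add: Y_def)
    have exp: "cos (\<i> * of_real Y) + \<i> * sin (\<i> * of_real Y) = of_real (exp (- Y))"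
    proof -
      have "exp (\<i> * (\<i> * of_real Y)) = cos (\<i> * of_real Y) + \<i> * sin (\<i> * of_real Y)"
        by (rule exp_Euler)
      moreover have "\<i> * (\<i> * of_real Y) = of_real (- Y)" by (simp flip: mult.assoc)
      ultimately show ?thesis by (metis exp_of_real)
    qed
    have "(g a - (\<Lambda> - \<i>)) * sin (\<i> * of_real Y) =
        ((g a - \<Lambda>) * sin (\<i> * of_real Y) - cos (\<i> * of_real Y)) + of_real (exp (- Y))"
      unfolding exp[symmetric] by (simp add: algebra_simps)
    also have "cmod \<dots> \<le> 1 + exp (- Y)"
      using disc[OF a] by (intro order_trans[OF norm_triangle_ineq] add_mono) (auto simp: Y_def)
    also have "\<dots> \<le> 2" using Y by simp
    finally have "cmod (g a - (\<Lambda> - \<i>)) * sinh Y \<le> 2"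
      using Y by (simp add: norm_mult sin_i_times_of_real)
    moreover have "cmod (g a - (\<Lambda> - \<i>)) * Y \<le> cmod (g a - (\<Lambda> - \<i>)) * sinh Y"
      using Y le_sinh[of Y] by (intro mult_left_mono) auto
    ultimately show ?thesis using Y by (simp add: field_simps flip: Y_def)
  qed
  define N where "N = cmod (\<Lambda> - \<i>) + 2 / \<tau>"
  have N: "N > 0" using \<tau> by (simp add: N_def add_nonneg_pos)
  have upper: "\<bar>Im a\<bar> * cmod (g a) \<le> N * R" if a: "Im a > 0" "cmod a = R" "R \<ge> 1" for a R
  proof -
    have "cmod (g a) \<le> cmod (\<Lambda> - \<i>) + 2 / (\<tau> * Im a)"
      using near[OF a(1)] norm_triangle_ineq2[of "g a" "\<Lambda> - \<i>"] by linarith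
    then have "\<bar>Im a\<bar> * cmod (g a) \<le> Im a * (cmod (\<Lambda> - \<i>) + 2 / (\<tau> * Im a))"
      using a by simp
    also have "\<dots> = Im a * cmod (\<Lambda> - \<i>) + 2 / \<tau>" using a \<tau> by (simp add: field_simps)
    also have "\<dots> \<le> R * cmod (\<Lambda> - \<i>) + R * (2 / \<tau>)"
    proof (rule add_mono)
      show "Im a * cmod (\<Lambda> - \<i>) \<le> R * cmod (\<Lambda> - \<i>)"
        using abs_Im_le_cmod[of a] a by (intro mult_right_mono) auto
      show "2 / \<tau> \<le> R * (2 / \<tau>)" using a \<tau> mult_right_mono[of 1 R "2 / \<tau>"] by simp
    qed
    finally show ?thesis by (simp add: N_def algebra_simps)
  qed
  have both: "\<bar>Im a\<bar> * cmod (g a) \<le> N * R" if a: "Im a \<noteq> 0" "cmod a = R" "R \<ge> 1" for a R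
  proof (cases "Im a > 0")
    case True
    then show ?thesis using upper a by blast
  next
    case False
    then show ?thesis using upper[of "cnj a" R] a by (simp add: real)
  qed
  have bounded: "cmod (g z) \<le> 8 * N" for z
  proof -
    \<comment> \<open>A radius of at least 1 and at least \<open>2 |z|\<close>, so that \<open>R\<^sup>2 - |z|\<^sup>2 \<ge> R\<^sup>2 / 4\<close>.\<close>
    define R where "R = 2 * (cmod z + 1)"
    have R: "R \<ge> 1" "cmod z \<le> R / 2" by (simp_all add: R_def)
    have "(R\<^sup>2 - (cmod z)\<^sup>2) * cmod (g z) \<le> 2 * R * (N * R)"
      using both R by (intro entire_bound_of_real_axis_bound[OF g]) auto
    moreover have "(cmod z)\<^sup>2 \<le> R\<^sup>2 / 4"
      using power_mono[OF R(2), of 2] by (simp add: power_divide)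
    then have "R\<^sup>2 / 4 \<le> R\<^sup>2 - (cmod z)\<^sup>2"
      using zero_le_power2[of R] by linarith
    then have "R\<^sup>2 / 4 * cmod (g z) \<le> (R\<^sup>2 - (cmod z)\<^sup>2) * cmod (g z)"
      by (intro mult_right_mono) auto
    ultimately have "R\<^sup>2 / 4 * cmod (g z) \<le> 2 * R * (N * R)" by linarith
    then have "R\<^sup>2 * cmod (g z) \<le> R\<^sup>2 * (8 * N)" by (simp add: power2_eq_square mult_ac)
    then show ?thesis using R by simp
  qed
  then have "bounded (range g)" unfolding bounded_iff by auto
  then obtain \<gamma> where \<gamma>: "g z = \<gamma>" for z
    using Liouville_theorem[OF g] unfolding constant_on_def by auto
  have "cmod (\<gamma> - (\<Lambda> - \<i>)) \<le> 0"
  proof (rule tendsto_lowerbound)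
    show "((\<lambda>y. 2 / (\<tau> * y)) \<longlongrightarrow> 0) at_top" using \<tau> by real_asymp
    show "\<forall>\<^sub>F y in at_top. cmod (\<gamma> - (\<Lambda> - \<i>)) \<le> 2 / (\<tau> * y)"
      using eventually_gt_at_top[of 0]
    proof eventually_elim
      case (elim y)
      then show ?case using near[of "\<i> * of_real y"] by (simp add: \<gamma>)
    qed
  qed simp
  then have \<gamma>\<Lambda>: "\<gamma> = \<Lambda> - \<i>" by simp
  have "\<gamma> = cnj \<gamma>" using real[of 0] by (simp add: \<gamma>)
  then have "Im \<gamma> = 0" by (metis cnj.simps(2) equal_neg_zero)
  then show "Im \<Lambda> = 1" using \<gamma>\<Lambda> by simp
  then show "g a = of_real (Re \<Lambda>)" using \<gamma>\<Lambda> by (simp add: \<gamma> complex_eq_iff)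
qed

text \<open>
  The form in which the hypothesis on the kernel is used: along any continuous choice of the two
  arguments over a compact set, and for the numerators \<open>(a - b) K n a b\<close>, which are Wronskians in the
  application.
\<close>

lemma sine_kernel_compose_limit:
  fixes K :: "nat \<Rightarrow> complex \<Rightarrow> complex \<Rightarrow> complex" and \<phi> \<psi> :: "'a :: topological_space \<Rightarrow> complex"
  assumes K: "\<And>C. compact C \<Longrightarrow> uniform_limit (C \<times> C) (\<lambda>n (a, b). K n a b)
        (\<lambda>(a, b). sin_quotient c (b - a) / v) sequentially"
    and D: "compact D" and cont: "continuous_on D \<phi>" "continuous_on D \<psi>"
  shows sine_kernel_compose: "uniform_limit D (\<lambda>n x. K n (\<phi> x) (\<psi> x))
          (\<lambda>x. sin_quotient c (\<psi> x - \<phi> x) / v) sequentially"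
    and sine_kernel_numerator: "uniform_limit D (\<lambda>n x. (\<phi> x - \<psi> x) * K n (\<phi> x) (\<psi> x))
          (\<lambda>x. - sin (of_real c * (\<psi> x - \<phi> x)) / v) sequentially"
proof -
  define C where "C = \<phi> ` D \<union> \<psi> ` D"
  have "compact C" using D cont by (auto simp: C_def intro: compact_continuous_image)
  then have "uniform_limit (C \<times> C) (\<lambda>n (a, b). K n a b)
        (\<lambda>(a, b). sin_quotient c (b - a) / v) sequentially" by (rule K)
  from uniform_limit_compose'[OF this, of "\<lambda>x. (\<phi> x, \<psi> x)" D]
  show lim: "uniform_limit D (\<lambda>n x. K n (\<phi> x) (\<psi> x)) (\<lambda>x. sin_quotient c (\<psi> x - \<phi> x) / v) sequentially"
    by (simp add: C_def)
  have bounded: "bounded (f ` D)" if "continuous_on D f" for f :: "'a \<Rightarrow> complex"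
    using D that compact_imp_bounded compact_continuous_image by blast
  have "uniform_limit D (\<lambda>n x. (\<phi> x - \<psi> x) * K n (\<phi> x) (\<psi> x))
          (\<lambda>x. (\<phi> x - \<psi> x) * (sin_quotient c (\<psi> x - \<phi> x) / v)) sequentially"
  proof (intro uniform_lim_mult lim uniform_limit_const bounded)
    show "continuous_on D (\<lambda>x. \<phi> x - \<psi> x)" by (intro continuous_intros cont)
    have "continuous_on D (\<lambda>x. sin_quotient c (\<psi> x - \<phi> x))"
      by (rule continuous_on_compose2[OF holomorphic_on_imp_continuous_on[OF sin_quotient_holomorphic]])
         (auto intro!: continuous_intros cont)
    then show "continuous_on D (\<lambda>x. sin_quotient c (\<psi> x - \<phi> x) / v)"
      unfolding divide_inverse by (intro continuous_intros)
  qed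
  then show "uniform_limit D (\<lambda>n x. (\<phi> x - \<psi> x) * K n (\<phi> x) (\<psi> x))
          (\<lambda>x. - sin (of_real c * (\<psi> x - \<phi> x)) / v) sequentially"
    by (simp add: sin_quotient_mult)
qed

lemma uniform_limit_eventually_bounded:
  fixes f :: "nat \<Rightarrow> 'a \<Rightarrow> complex"
  assumes "uniform_limit D f l sequentially" "bounded (l ` D)"
  obtains B where "B > 0" "\<forall>\<^sub>F n in sequentially. \<forall>x\<in>D. cmod (f n x) \<le> B"
proof -
  obtain B where B: "B > 0" "\<forall>x\<in>D. cmod (l x) \<le> B"
    using assms(2) unfolding bounded_pos by auto
  have "\<forall>\<^sub>F n in sequentially. \<forall>x\<in>D. dist (f n x) (l x) < 1"
    using uniform_limitD[OF assms(1)] by simp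
  then have "\<forall>\<^sub>F n in sequentially. \<forall>x\<in>D. cmod (f n x) \<le> B + 1"
  proof eventually_elim
    case (elim n)
    show ?case
    proof
      fix x assume x: "x \<in> D"
      with elim B have "cmod (f n x - l x) < 1" "cmod (l x) \<le> B" by (auto simp: dist_norm)
      then show "cmod (f n x) \<le> B + 1" using norm_triangle_ineq2[of "f n x" "l x"] by linarith
    qed
  qed
  then show ?thesis using B by (intro that[of "B + 1"]) auto
qed

text \<open>
  Here \<open>k\<close> stands for \<open>[P a, P b]\<close>, \<open>G\<close> for \<open>[Q a, P (a + s)]\<close> and \<open>\<Phi>\<close> for the rescaled Stieltjes
  transform. The shift \<open>s\<close> is a quarter period of the sine, so that \<open>k n a (a + s)\<close> tends to
  \<open>- 1 / v\<close>. Multiplied by \<open>|Im a|\<close>, the disc condition bounds \<open>G\<close> on circles, because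
  \<open>k n a (cnj a) = 2 \<i> Im a K n a (cnj a)\<close> is at least a constant times \<open>Im a\<close>; this gives a normal
  family. In the limit the condition becomes that of \<open>weyl_disc_rigidity\<close> with \<open>\<Lambda> = L / v\<close>, which
  determines the limit of \<open>G\<close> and, since a limit exists, also \<open>Im L\<close>.
\<close>

lemma weyl_discs_converge:
  fixes K k :: "nat \<Rightarrow> complex \<Rightarrow> complex \<Rightarrow> complex" and G \<Phi> :: "nat \<Rightarrow> complex \<Rightarrow> complex"
  assumes K: "\<And>C. compact C \<Longrightarrow> uniform_limit (C \<times> C) (\<lambda>n (a, b). K n a b)
        (\<lambda>(a, b). sin_quotient c (b - a) / of_real v) sequentially"
    and c: "c > 0" and v: "v > 0" and s: "c * s = pi / 2"
    and k: "\<And>n a b. k n a b = (a - b) * K n a b"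
    and G: "\<And>n. G n holomorphic_on UNIV"
    and real: "\<forall>\<^sub>F n in sequentially. \<forall>a. G n (cnj a) = cnj (G n a)"
    and disc: "\<forall>\<^sub>F n in sequentially. \<forall>a. Im a > 0 \<longrightarrow>
        cmod ((G n a + \<Phi> n a * k n a (a + of_real s)) * k n a (cnj a) - k n (a + of_real s) (cnj a))
          \<le> cmod (k n a (a + of_real s))"
    and M: "\<forall>\<^sub>F n in sequentially. \<forall>a. Im a > 0 \<longrightarrow>
        cmod (\<Phi> n a) \<le> M * (1 + cmod (a - \<i>) * (1 + cmod (a - \<i>) / Im a))" "M \<ge> 0"
    and \<Phi>: "\<And>a. Im a > 0 \<Longrightarrow> (\<lambda>n. \<Phi> n a) \<longlonglongrightarrow> L"
  shows "Im L = v" and "compact C \<Longrightarrow> uniform_limit C G (\<lambda>_. of_real (Re L / v)) sequentially"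
proof -
  note [continuous_intros] =
    continuous_on_compose2[OF holomorphic_on_imp_continuous_on[OF sin_quotient_holomorphic]]
  have klim: "uniform_limit D (\<lambda>n a. k n (\<phi> a) (\<psi> a))
      (\<lambda>a. - sin (of_real c * (\<psi> a - \<phi> a)) / of_real v) sequentially"
    if "compact D" "continuous_on D \<phi>" "continuous_on D \<psi>" for D :: "complex set" and \<phi> \<psi>
    unfolding k by (rule sine_kernel_numerator[OF K that])
  have cont: "continuous_on D (\<lambda>a. a)" "continuous_on D (\<lambda>a. a + of_real s)" "continuous_on D cnj"
    for D :: "complex set" by (intro continuous_intros)+
  have bdd: "bounded (f ` D)" if "continuous_on D f" "compact D"
    for f :: "complex \<Rightarrow> complex" and D
    using that compact_imp_bounded compact_continuous_image by blast
  \<comment> \<open>Near the real points of a circle the bound on \<open>G\<close> degenerates at worst like \<open>1 / |Im a|\<close>.\<close>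
  have circle: "\<exists>N. \<forall>\<^sub>F n in sequentially. \<forall>a. cmod a = R \<longrightarrow> Im a \<noteq> 0 \<longrightarrow> \<bar>Im a\<bar> * cmod (G n a) \<le> N"
    if R: "R > 0" for R
  proof -
    define D where "D = cball (0 :: complex) R"
    have D: "compact D" by (simp add: D_def)
    have contB1: "continuous_on D (\<lambda>a. - sin (of_real c * (a + of_real s - a)) / of_real v)"
      unfolding divide_inverse by (intro continuous_intros)
    obtain B1 where B1: "B1 > 0" "\<forall>\<^sub>F n in sequentially. \<forall>a\<in>D. cmod (k n a (a + of_real s)) \<le> B1"
      using uniform_limit_eventually_bounded[OF klim[OF D cont(1,2)] bdd[OF contB1 D]] by blast
    have contB2: "continuous_on D (\<lambda>a. - sin (of_real c * (cnj a - (a + of_real s))) / of_real v)"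
      unfolding divide_inverse by (intro continuous_intros)
    obtain B2 where B2: "B2 > 0" "\<forall>\<^sub>F n in sequentially. \<forall>a\<in>D. cmod (k n (a + of_real s) (cnj a)) \<le> B2"
      using uniform_limit_eventually_bounded[OF klim[OF D cont(2,3)] bdd[OF contB2 D]] by blast
    have "\<forall>\<^sub>F n in sequentially. \<forall>a\<in>D. dist (K n a (cnj a)) (sin_quotient c (cnj a - a) / of_real v) < c / (2 * v)"
      using c v by (intro uniform_limitD[OF sine_kernel_compose[OF K D cont(1,3)]]) auto
    then have "\<forall>\<^sub>F n in sequentially. \<forall>a. cmod a = R \<longrightarrow> Im a > 0 \<longrightarrow>
        \<bar>Im a\<bar> * cmod (G n a) \<le> (B2 + B1) * v / c + M * (R + (R + 1) * (R + (R + 1))) * B1"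
      using B1(2) B2(2) disc M(1)
    proof eventually_elim
      case (elim n)
      show ?case
      proof (intro allI impI)
        fix a assume a: "cmod a = R" "Im a > 0"
        define y where "y = Im a"
        have y: "y > 0" "y \<le> R" using a abs_Im_le_cmod[of a] by (auto simp: y_def)
        have aD: "a \<in> D" using a by (simp add: D_def)
        have aa: "cnj a - a = - 2 * \<i> * of_real y" by (simp add: complex_eq_iff y_def)
        have "c / v \<le> cmod (sin_quotient c (cnj a - a) / of_real v)"
          using sin_quotient_imaginary_ge[OF c y(1)] v
          unfolding aa by (simp add: norm_divide divide_right_mono)
        moreover have "cmod (K n a (cnj a) - sin_quotient c (cnj a - a) / of_real v) < c / (2 * v)"
          using elim(1) aD by (auto simp: dist_norm)
        ultimately have "c / (2 * v) \<le> cmod (K n a (cnj a))"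
          using norm_triangle_ineq2[of "sin_quotient c (cnj a - a) / of_real v" "K n a (cnj a)"]
          by (simp add: norm_minus_commute field_simps)
        then have kl: "c / v * y \<le> cmod (k n a (cnj a))"
        proof -
          assume le: "c / (2 * v) \<le> cmod (K n a (cnj a))"
          have "a - cnj a = 2 * \<i> * of_real y" by (simp add: complex_eq_iff y_def)
          then have "cmod (k n a (cnj a)) = 2 * y * cmod (K n a (cnj a))"
            using y by (simp add: k norm_mult)
          also have "\<dots> \<ge> 2 * y * (c / (2 * v))" using le y by (intro mult_left_mono) auto
          finally show ?thesis using v by (simp add: field_simps)
        qed
        define E where "E = G n a + \<Phi> n a * k n a (a + of_real s)"
        have "cmod (E * k n a (cnj a)) \<le> B2 + B1"
        proof -
          have "cmod (E * k n a (cnj a) - k n (a + of_real s) (cnj a)) \<le> B1"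
            using elim(2,4) a aD unfolding E_def by (meson order_trans)
          moreover have "cmod (k n (a + of_real s) (cnj a)) \<le> B2" using elim(3) aD by blast
          ultimately show ?thesis
            using norm_triangle_ineq2[of "E * k n a (cnj a)" "k n (a + of_real s) (cnj a)"] by linarith
        qed
        moreover have "cmod E * (c / v * y) \<le> cmod E * cmod (k n a (cnj a))"
          using kl by (intro mult_left_mono) auto
        ultimately have "cmod E * (c / v * y) \<le> B2 + B1" by (simp add: norm_mult)
        then have yE: "y * cmod E \<le> (B2 + B1) * v / c"
          using c v by (simp add: field_simps)
        have "cmod (a - \<i>) \<le> R + 1" using norm_triangle_ineq4[of a \<i>] a by simp
        then have "y + cmod (a - \<i>) * (y + cmod (a - \<i>)) \<le> R + (R + 1) * (R + (R + 1))"
          using y R by (intro add_mono mult_mono) auto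
        moreover have "y * cmod (\<Phi> n a) \<le> y * (M * (1 + cmod (a - \<i>) * (1 + cmod (a - \<i>) / y)))"
          using elim(5) a y by (intro mult_left_mono) (auto simp: y_def)
        moreover have "y * (M * (1 + cmod (a - \<i>) * (1 + cmod (a - \<i>) / y))) =
            M * (y + cmod (a - \<i>) * (y + cmod (a - \<i>)))"
          using y by (simp add: field_simps)
        ultimately have y\<Phi>: "y * cmod (\<Phi> n a) \<le> M * (R + (R + 1) * (R + (R + 1)))"
          using mult_left_mono[OF _ M(2)] by (metis order_trans)
        have "cmod (G n a) \<le> cmod E + cmod (\<Phi> n a) * cmod (k n a (a + of_real s))"
          using norm_triangle_ineq4[of E "\<Phi> n a * k n a (a + of_real s)"]
          by (simp add: E_def norm_mult)
        also have "\<dots> \<le> cmod E + cmod (\<Phi> n a) * B1"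
          using elim(2) aD by (intro add_left_mono mult_left_mono) auto
        finally have "y * cmod (G n a) \<le> y * (cmod E + cmod (\<Phi> n a) * B1)"
          using y by (intro mult_left_mono) auto
        also have "\<dots> = y * cmod E + y * cmod (\<Phi> n a) * B1" by (simp add: algebra_simps)
        also have "\<dots> \<le> (B2 + B1) * v / c + M * (R + (R + 1) * (R + (R + 1))) * B1"
          using yE y\<Phi> B1(1) by (intro add_mono mult_right_mono) auto
        finally show "\<bar>Im a\<bar> * cmod (G n a) \<le> (B2 + B1) * v / c + M * (R + (R + 1) * (R + (R + 1))) * B1"
          using y by (simp add: y_def)
      qed
    qed
    then have "\<forall>\<^sub>F n in sequentially. \<forall>a. cmod a = R \<longrightarrow> Im a \<noteq> 0 \<longrightarrow>
        \<bar>Im a\<bar> * cmod (G n a) \<le> (B2 + B1) * v / c + M * (R + (R + 1) * (R + (R + 1))) * B1"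
      using real
    proof eventually_elim
      case (elim n)
      show ?case
      proof (intro allI impI)
        fix a assume a: "cmod a = R" "Im a \<noteq> 0"
        show "\<bar>Im a\<bar> * cmod (G n a) \<le> (B2 + B1) * v / c + M * (R + (R + 1) * (R + (R + 1))) * B1"
        proof (cases "Im a > 0")
          case True
          then show ?thesis using elim(1) a by blast
        next
          case False
          then have "Im (cnj a) > 0" "cmod (cnj a) = R" using a by auto
          with elim(1) have "\<bar>Im (cnj a)\<bar> * cmod (G n (cnj a)) \<le>
              (B2 + B1) * v / c + M * (R + (R + 1) * (R + (R + 1))) * B1" by blast
          then show ?thesis using elim(2) by simp
        qed
      qed
    qed
    then show ?thesis by blast
  qed
  have local_bound: "\<exists>B. \<forall>\<^sub>F n in sequentially. \<forall>z\<in>C. cmod (G n z) \<le> B" if C: "compact C" for C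
  proof -
    obtain R where R: "R > 0" "\<forall>z\<in>C. cmod z \<le> R"
      using compact_imp_bounded[OF C] unfolding bounded_pos by blast
    obtain N where N: "\<forall>\<^sub>F n in sequentially. \<forall>a. cmod a = 2 * R \<longrightarrow> Im a \<noteq> 0 \<longrightarrow> \<bar>Im a\<bar> * cmod (G n a) \<le> N"
      using circle[of "2 * R"] R by auto
    have "\<forall>\<^sub>F n in sequentially. \<forall>z\<in>C. cmod (G n z) \<le> 4 * R * N / (3 * R\<^sup>2)"
      using N
    proof eventually_elim
      case (elim n)
      show ?case
      proof
        fix z assume z: "z \<in> C"
        have "((2 * R)\<^sup>2 - (cmod z)\<^sup>2) * cmod (G n z) \<le> 2 * (2 * R) * N"
          using elim R z by (intro entire_bound_of_real_axis_bound[OF G]) force+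
        moreover have "3 * R\<^sup>2 \<le> (2 * R)\<^sup>2 - (cmod z)\<^sup>2"
          using power_mono[of "cmod z" R 2] R z by (simp add: power_mult_distrib)
        then have "3 * R\<^sup>2 * cmod (G n z) \<le> ((2 * R)\<^sup>2 - (cmod z)\<^sup>2) * cmod (G n z)"
          by (intro mult_right_mono) auto
        ultimately have "3 * R\<^sup>2 * cmod (G n z) \<le> 4 * R * N" by linarith
        then show "cmod (G n z) \<le> 4 * R * N / (3 * R\<^sup>2)" using R by (simp add: field_simps)
      qed
    qed
    then show ?thesis by blast
  qed
  have klim_pt: "(\<lambda>n. k n a b) \<longlonglongrightarrow> - sin (of_real c * (b - a)) / of_real v" for a b
    by (rule tendsto_uniform_limitI[OF klim[of "{a}" "\<lambda>_. a" "\<lambda>_. b"]]) auto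
  define \<Lambda> where "\<Lambda> = L / of_real v"
  have limit: "Im \<Lambda> = 1 \<and> g z = of_real (Re \<Lambda>)"
    if g: "g holomorphic_on UNIV" and r: "strict_mono (r :: nat \<Rightarrow> nat)"
      and lim: "\<And>z. (\<lambda>n. G (r n) z) \<longlonglongrightarrow> g z" for g r z
  proof -
    have greal: "g (cnj a) = cnj (g a)" for a
    proof (rule LIMSEQ_unique)
      show "(\<lambda>n. G (r n) (cnj a)) \<longlonglongrightarrow> g (cnj a)" by (rule lim)
      have "\<forall>\<^sub>F n in sequentially. cnj (G (r n) a) = G (r n) (cnj a)"
        using eventually_subseq[OF r real] by eventually_elim simp
      moreover have "(\<lambda>n. cnj (G (r n) a)) \<longlonglongrightarrow> cnj (g a)" by (intro tendsto_cnj lim)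
      ultimately show "(\<lambda>n. G (r n) (cnj a)) \<longlonglongrightarrow> cnj (g a)"
        by (rule Lim_transform_eventually[rotated])
    qed
    have gdisc: "cmod ((g a - \<Lambda>) * sin (\<i> * of_real (2 * c * Im a)) - cos (\<i> * of_real (2 * c * Im a))) \<le> 1"
      if a: "Im a > 0" for a
    proof -
      define Y where "Y = 2 * c * Im a"
      have cs: "complex_of_real c * of_real s = of_real (pi / 2)" by (simp only: s flip: of_real_mult)
      have e1: "- sin (of_real c * (a + of_real s - a)) / of_real v = - 1 / of_real v"
        using cs by (simp add: sin_of_real flip: of_real_divide)
      have aa: "cnj a - a = - 2 * \<i> * of_real (Im a)" by (simp add: complex_eq_iff)
      have caa: "of_real c * (cnj a - a) = - (\<i> * of_real Y)" unfolding aa by (simp add: Y_def)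
      have e2: "- sin (of_real c * (cnj a - a)) / of_real v = sin (\<i> * of_real Y) / of_real v"
        unfolding caa by simp
      have "of_real c * (cnj a - (a + of_real s)) = - (\<i> * of_real Y + of_real pi / 2)"
      proof -
        have "of_real c * (cnj a - (a + of_real s)) = of_real c * (cnj a - a) - of_real c * of_real s"
          by (simp add: algebra_simps)
        then show ?thesis unfolding caa cs by simp
      qed
      then have e3: "- sin (of_real c * (cnj a - (a + of_real s))) / of_real v = cos (\<i> * of_real Y) / of_real v"
        by (simp only: sin_minus sin_add) simp
      have kr: "(\<lambda>n. k (r n) x y) \<longlonglongrightarrow> - sin (of_real c * (y - x)) / of_real v" for x y
        using LIMSEQ_subseq_LIMSEQ[OF klim_pt r] by (simp add: o_def)
      have \<Phi>r: "(\<lambda>n. \<Phi> (r n) a) \<longlonglongrightarrow> L"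
        using LIMSEQ_subseq_LIMSEQ[OF \<Phi>[OF a] r] by (simp add: o_def)
      have "cmod ((g a + L * (- 1 / of_real v)) * (sin (\<i> * of_real Y) / of_real v)
          - cos (\<i> * of_real Y) / of_real v) \<le> cmod (- 1 / of_real v :: complex)"
      proof (rule tendsto_le[OF sequentially_bot])
        show "(\<lambda>n. cmod (k (r n) a (a + of_real s))) \<longlonglongrightarrow> cmod (- 1 / of_real v :: complex)"
          unfolding e1[symmetric] by (intro tendsto_norm kr)
        show "(\<lambda>n. cmod ((G (r n) a + \<Phi> (r n) a * k (r n) a (a + of_real s)) * k (r n) a (cnj a)
              - k (r n) (a + of_real s) (cnj a))) \<longlonglongrightarrow>
            cmod ((g a + L * (- 1 / of_real v)) * (sin (\<i> * of_real Y) / of_real v)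
          - cos (\<i> * of_real Y) / of_real v)"
          unfolding e1[symmetric] e2[symmetric] e3[symmetric]
          by (intro tendsto_intros kr lim \<Phi>r)
        show "\<forall>\<^sub>F n in sequentially. cmod ((G (r n) a + \<Phi> (r n) a * k (r n) a (a + of_real s)) * k (r n) a (cnj a)
              - k (r n) (a + of_real s) (cnj a)) \<le> cmod (k (r n) a (a + of_real s))"
          using eventually_subseq[OF r disc] by eventually_elim (use a in auto)
      qed
      also have "(g a + L * (- 1 / of_real v)) * (sin (\<i> * of_real Y) / of_real v)
          - cos (\<i> * of_real Y) / of_real v = ((g a - \<Lambda>) * sin (\<i> * of_real Y) - cos (\<i> * of_real Y)) / of_real v"
        by (simp add: \<Lambda>_def diff_divide_distrib)
      finally have "cmod ((g a - \<Lambda>) * sin (\<i> * of_real Y) - cos (\<i> * of_real Y)) / v \<le> 1 / v"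
        using v by (simp only: norm_divide norm_of_real norm_minus_cancel norm_one)
      then show ?thesis using v by (simp add: Y_def divide_le_cancel)
    qed
    show ?thesis
      using weyl_disc_rigidity[OF g greal _ gdisc] c by simp
  qed
  have uniform: "uniform_limit C G (\<lambda>_. of_real (Re \<Lambda>)) sequentially" if "compact C" for C
    by (rule Vitali_uniform_limit[OF open_UNIV G _ _ that]) (use local_bound limit in auto)
  have "Im \<Lambda> = 1"
  proof -
    have "(\<lambda>n. G (id n) z) \<longlonglongrightarrow> of_real (Re \<Lambda>)" for z
      using tendsto_uniform_limitI[OF uniform[of "{z}"]] by simp
    from limit[OF _ _ this] show ?thesis by (simp add: strict_mono_id)
  qed
  then show "Im L = v" using v by (simp add: \<Lambda>_def Im_divide_of_real)
  show "uniform_limit C G (\<lambda>_. of_real (Re L / v)) sequentially" if "compact C"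
    using uniform[OF that] by (simp add: \<Lambda>_def Re_divide_of_real)
qed

section \<open>Convergence of the second kind kernel\<close>

text \<open>
  At distance at least 1 from the diagonal the factor \<open>a - b\<close> can simply be dropped. Nearer to the
  diagonal, the maximum principle in \<open>a\<close> on the disc of radius 1 about \<open>b\<close> reduces to that case.
\<close>

lemma uniform_limit_of_mult_diff:
  fixes f :: "nat \<Rightarrow> complex \<Rightarrow> complex \<Rightarrow> complex"
  assumes f: "\<And>n b. (\<lambda>a. f n a b) holomorphic_on UNIV" and l: "\<And>b. (\<lambda>a. l a b) holomorphic_on UNIV"
    and lim: "\<And>C. compact C \<Longrightarrow> uniform_limit (C \<times> C) (\<lambda>n (a, b). (a - b) * f n a b)
        (\<lambda>(a, b). (a - b) * l a b) sequentially"
    and C: "compact C"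
  shows "uniform_limit (C \<times> C) (\<lambda>n (a, b). f n a b) (\<lambda>(a, b). l a b) sequentially"
proof (rule uniform_limitI)
  fix e :: real assume e: "e > 0"
  \<comment> \<open>The 1-neighbourhood of \<open>C\<close> contains all the circles used below.\<close>
  define C' where "C' = {x + y | x y. x \<in> C \<and> y \<in> cball 0 1}"
  have "compact C'" unfolding C'_def using C by (intro compact_sums) auto
  from uniform_limitD[OF lim[OF this], of "e / 2"] e
  have "\<forall>\<^sub>F n in sequentially. \<forall>x\<in>C' \<times> C'. dist (case x of (a, b) \<Rightarrow> (a - b) * f n a b)
      (case x of (a, b) \<Rightarrow> (a - b) * l a b) < e / 2" by simp
  then show "\<forall>\<^sub>F n in sequentially. \<forall>x\<in>C \<times> C. dist (case x of (a, b) \<Rightarrow> f n a b)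
      (case x of (a, b) \<Rightarrow> l a b) < e"
  proof eventually_elim
    case (elim n)
    have far: "cmod (f n a b - l a b) \<le> e / 2" if "a \<in> C'" "b \<in> C'" "cmod (a - b) \<ge> 1" for a b
    proof -
      have "dist ((a - b) * f n a b) ((a - b) * l a b) < e / 2"
        using elim[rule_format, of "(a, b)"] that by simp
      then have "cmod (a - b) * cmod (f n a b - l a b) < e / 2"
        by (simp add: dist_norm flip: right_diff_distrib norm_mult)
      moreover have "1 * cmod (f n a b - l a b) \<le> cmod (a - b) * cmod (f n a b - l a b)"
        using that by (intro mult_right_mono) auto
      ultimately show ?thesis by linarith
    qed
    have "cmod (f n a b - l a b) \<le> e / 2" if a: "a \<in> C" and b: "b \<in> C" for a b
    proof (cases "cmod (a - b) \<ge> 1")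
      case True
      have "x \<in> C'" if "x \<in> C" for x unfolding C'_def using that by (intro CollectI exI[of _ x] exI[of _ 0]) auto
      then show ?thesis using far True a b by blast
    next
      case False
      have hol: "(\<lambda>z. f n z b - l z b) holomorphic_on UNIV" by (intro holomorphic_intros f l)
      show ?thesis
      proof (rule maximum_modulus_frontier[where f = "\<lambda>z. f n z b - l z b" and S = "cball b 1"])
        show "(\<lambda>z. f n z b - l z b) holomorphic_on interior (cball b 1)"
          by (rule holomorphic_on_subset[OF hol]) simp
        show "continuous_on (closure (cball b 1)) (\<lambda>z. f n z b - l z b)"
          by (rule holomorphic_on_imp_continuous_on[OF holomorphic_on_subset[OF hol]]) simp
        fix z assume "z \<in> frontier (cball b 1)"
        then have z: "cmod (z - b) = 1" by (simp add: dist_norm norm_minus_commute)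
        have "z \<in> C'" unfolding C'_def using b z by (intro CollectI exI[of _ b] exI[of _ "z - b"]) auto
        moreover have "b \<in> C'" unfolding C'_def using b by (intro CollectI exI[of _ b] exI[of _ 0]) auto
        ultimately show "cmod (f n z b - l z b) \<le> e / 2" using far z by simp
      qed (use False in \<open>auto simp: dist_norm norm_minus_commute\<close>)
    qed
    then show ?case using e by (force simp: dist_norm)
  qed
qed

text \<open>
  The identity assumed between \<open>Kt\<close>, \<open>k\<close> and \<open>G\<close> is \<open>[Q a, Q b]\<close> after expanding \<open>Q a\<close> in the basis
  \<open>P a, P (a + s)\<close> and \<open>Q b\<close> in the basis \<open>P b, P (b + s)\<close>. In the limit the two cross terms
  cancel, because the shift by a quarter period turns both sines into the same cosine, and the
  remaining terms combine to \<open>(1 + \<gamma>\<^sup>2) v\<^sup>2\<close> times the limit of \<open>k\<close>.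
\<close>

lemma second_kernel_limit:
  fixes K k Kt :: "nat \<Rightarrow> complex \<Rightarrow> complex \<Rightarrow> complex" and G :: "nat \<Rightarrow> complex \<Rightarrow> complex"
  assumes K: "\<And>C. compact C \<Longrightarrow> uniform_limit (C \<times> C) (\<lambda>n (a, b). K n a b)
        (\<lambda>(a, b). sin_quotient c (b - a) / of_real v) sequentially"
    and v: "v > 0" and s: "c * s = pi / 2"
    and k: "\<And>n a b. k n a b = (a - b) * K n a b"
    and G: "\<And>C. compact C \<Longrightarrow> uniform_limit C G (\<lambda>_. of_real \<gamma>) sequentially"
    and Kt: "\<And>n b. (\<lambda>a. Kt n a b) holomorphic_on UNIV"
    and eq: "\<forall>\<^sub>F n in sequentially. \<forall>a b.
        (a - b) * Kt n a b * (k n a (a + of_real s) * k n b (b + of_real s)) =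
          k n (a + of_real s) (b + of_real s) + G n b * k n b (a + of_real s)
          - G n a * k n a (b + of_real s) - G n a * G n b * k n b a"
    and C: "compact C"
  shows "uniform_limit (C \<times> C) (\<lambda>n (a, b). Kt n a b)
      (\<lambda>(a, b). of_real (v * (1 + \<gamma>\<^sup>2)) * sin_quotient c (b - a)) sequentially"
proof (rule uniform_limit_of_mult_diff[OF Kt _ _ C])
  show "(\<lambda>a. of_real (v * (1 + \<gamma>\<^sup>2)) * sin_quotient c (b - a)) holomorphic_on UNIV" for b
  proof (intro holomorphic_intros)
    have "(sin_quotient c \<circ> (\<lambda>a. b - a)) holomorphic_on UNIV"
      by (intro holomorphic_on_compose_gen[OF _ sin_quotient_holomorphic] holomorphic_intros) auto
    then show "(\<lambda>a. sin_quotient c (b - a)) holomorphic_on UNIV" by (simp add: o_def)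
  qed
  fix C :: "complex set" assume C: "compact C"
  define D where "D = C \<times> C"
  have D: "compact D" using C by (auto simp: D_def intro: compact_Times)
  have klim: "uniform_limit D (\<lambda>n x. k n (\<phi> x) (\<psi> x))
      (\<lambda>x. - sin (of_real c * (\<psi> x - \<phi> x)) / of_real v) sequentially"
    if "continuous_on D \<phi>" "continuous_on D \<psi>" for \<phi> \<psi>
    unfolding k by (rule sine_kernel_numerator[OF K D that])
  have bdd: "bounded (f ` D)" if "continuous_on D f" for f :: "complex \<times> complex \<Rightarrow> complex"
    using that D compact_imp_bounded compact_continuous_image by blast
  have G1: "uniform_limit D (\<lambda>n x. G n (fst x)) (\<lambda>_. of_real \<gamma>) sequentially"
    by (rule uniform_limit_compose'[OF G[OF C]]) (auto simp: D_def)
  have G2: "uniform_limit D (\<lambda>n x. G n (snd x)) (\<lambda>_. of_real \<gamma>) sequentially"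
    by (rule uniform_limit_compose'[OF G[OF C]]) (auto simp: D_def)
  define S where "S = (\<lambda>z :: complex. - sin (of_real c * z) / of_real v)"
  have contS: "continuous_on D (\<lambda>x. S (f x))" if "continuous_on D f" for f
    unfolding S_def divide_inverse by (intro continuous_intros that)
  have klim': "uniform_limit D (\<lambda>n x. k n (\<phi> x) (\<psi> x)) (\<lambda>x. S (\<psi> x - \<phi> x)) sequentially"
    if "continuous_on D \<phi>" "continuous_on D \<psi>" for \<phi> \<psi>
    using klim[OF that] by (simp add: S_def)
  define num where "num = (\<lambda>n x. k n (fst x + of_real s) (snd x + of_real s)
      + G n (snd x) * k n (snd x) (fst x + of_real s)
      - G n (fst x) * k n (fst x) (snd x + of_real s) - G n (fst x) * G n (snd x) * k n (snd x) (fst x))"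
  define den where "den = (\<lambda>n x. k n (fst x) (fst x + of_real s) * k n (snd x) (snd x + of_real s))"
  have num: "uniform_limit D num (\<lambda>x. S (snd x + of_real s - (fst x + of_real s))
      + of_real \<gamma> * S (fst x + of_real s - snd x)
      - of_real \<gamma> * S (snd x + of_real s - fst x) - of_real \<gamma> * of_real \<gamma> * S (fst x - snd x)) sequentially"
    unfolding num_def
    by (intro uniform_limit_add uniform_limit_minus uniform_lim_mult G1 G2 klim' bdd contS continuous_intros)
  have den: "uniform_limit D den (\<lambda>x. S (fst x + of_real s - fst x) * S (snd x + of_real s - snd x)) sequentially"
    unfolding den_def by (intro uniform_lim_mult klim' bdd contS continuous_intros)
  have cs: "complex_of_real c * of_real s = of_real (pi / 2)" by (simp only: s flip: of_real_mult)
  have Ss: "S (z + of_real s) = - cos (of_real c * z) / of_real v" for z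
    unfolding S_def distrib_left cs sin_add by (simp add: sin_of_real cos_of_real)
  have Sminus: "S (- z) = - S z" for z by (simp add: S_def)
  have num_eq: "S (snd x + of_real s - (fst x + of_real s)) + of_real \<gamma> * S (fst x + of_real s - snd x)
      - of_real \<gamma> * S (snd x + of_real s - fst x) - of_real \<gamma> * of_real \<gamma> * S (fst x - snd x) =
      of_real (1 + \<gamma>\<^sup>2) * S (snd x - fst x)" for x
  proof -
    define z where "z = snd x - fst x"
    have "fst x + of_real s - snd x = - z + of_real s" by (simp add: z_def)
    then have 1: "S (fst x + of_real s - snd x) = - cos (of_real c * z) / of_real v"
      by (simp only: Ss mult_minus_right cos_minus)
    have "snd x + of_real s - fst x = z + of_real s" by (simp add: z_def)
    then have 2: "S (snd x + of_real s - fst x) = - cos (of_real c * z) / of_real v"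
      by (simp only: Ss)
    have "fst x - snd x = - z" by (simp add: z_def)
    then have 3: "S (fst x - snd x) = - S z" by (simp only: Sminus)
    have 4: "snd x + of_real s - (fst x + of_real s) = z" by (simp add: z_def)
    show ?thesis unfolding 1 2 3 4 z_def[symmetric] by (simp add: algebra_simps power2_eq_square)
  qed
  have den_eq: "S (fst x + of_real s - fst x) * S (snd x + of_real s - snd x) = 1 / of_real (v\<^sup>2)" for x
    using Ss[of 0] by (simp add: power2_eq_square)
  note num = num[unfolded num_eq]
  note den = den[unfolded den_eq]
  have "uniform_limit D (\<lambda>n x. num n x / den n x)
      (\<lambda>x. of_real (1 + \<gamma>\<^sup>2) * S (snd x - fst x) / (1 / of_real (v\<^sup>2))) sequentially"
  proof (rule uniform_lim_divide[OF num den])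
    show "bounded ((\<lambda>x. of_real (1 + \<gamma>\<^sup>2) * S (snd x - fst x)) ` D)"
      by (intro bdd continuous_on_mult continuous_on_const contS continuous_intros)
    show "1 / v\<^sup>2 \<le> cmod (1 / of_real (v\<^sup>2))" by (simp add: norm_divide norm_power)
    show "1 / v\<^sup>2 > 0" using v by simp
  qed
  moreover have "\<forall>\<^sub>F n in sequentially. \<forall>x\<in>D. num n x / den n x = (case x of (a, b) \<Rightarrow> (a - b) * Kt n a b)"
  proof -
    have "\<forall>\<^sub>F n in sequentially. \<forall>x\<in>D. dist (den n x) (1 / of_real (v\<^sup>2)) < 1 / v\<^sup>2"
      using v by (intro uniform_limitD[OF den]) auto
    then show ?thesis using eq
    proof eventually_elim
      case (elim n)
      show ?case
      proof
        fix x assume "x \<in> D"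
        then have "den n x \<noteq> 0" using elim(1) v by (auto simp: dist_norm norm_divide norm_power)
        moreover have "(fst x - snd x) * Kt n (fst x) (snd x) * den n x = num n x"
          using elim(2) unfolding den_def num_def by blast
        ultimately show "num n x / den n x = (case x of (a, b) \<Rightarrow> (a - b) * Kt n a b)"
          by (simp add: case_prod_beta divide_eq_eq)
      qed
    qed
  qed
  moreover have "of_real (1 + \<gamma>\<^sup>2) * S (snd x - fst x) / (1 / of_real (v\<^sup>2)) =
      (case x of (a, b) \<Rightarrow> (a - b) * (of_real (v * (1 + \<gamma>\<^sup>2)) * sin_quotient c (b - a)))" for x
  proof -
    have "(fst x - snd x) * (of_real (v * (1 + \<gamma>\<^sup>2)) * sin_quotient c (snd x - fst x)) =
        of_real (v * (1 + \<gamma>\<^sup>2)) * ((fst x - snd x) * sin_quotient c (snd x - fst x))"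
      by (simp only: mult_ac)
    then show ?thesis using v
      by (simp add: sin_quotient_mult case_prod_beta S_def power2_eq_square field_simps)
  qed
  ultimately show "uniform_limit (C \<times> C) (\<lambda>n (a, b). (a - b) * Kt n a b)
      (\<lambda>(a, b). (a - b) * (of_real (v * (1 + \<gamma>\<^sup>2)) * sin_quotient c (b - a))) sequentially"
    unfolding D_def[symmetric] by (subst uniform_limit_cong[symmetric]) auto
qed

text \<open>
  Both properties pass through the recurrence, whose coefficients are real and whose leading
  coefficients do not vanish.
\<close>

lemma second_kind_entire:
  assumes \<mu>: "nontrivial_cpt_prob_measure \<mu>" and p: "orthonormal_polys \<mu> p"
    and ab: "jacobi_parameters \<mu> a b"
  shows "second_kind \<mu> (p j) holomorphic_on UNIV"
    and "second_kind \<mu> (p j) (cnj x) = cnj (second_kind \<mu> (p j) x)"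
proof -
  define q where "q = (\<lambda>j x. second_kind \<mu> (p j) x)"
  have q: "jacobi_solution a b x 1 (\<lambda>j. q j x)" and q0: "q 0 x = 0" for x
    using second_kind_jacobi_solution[OF assms] by (simp_all add: q_def)
  have pos: "a n > 0" if "n \<ge> 1" for n using ab that unfolding jacobi_parameters_def by blast
  have q1: "q 1 x = 1 / of_real (a 1)" for x
  proof -
    have "x * q 0 x = of_real (a 1) * q 1 x + of_real (b 1) * q 0 x - 1"
      using q[of x] unfolding jacobi_solution_def by blast
    then show ?thesis using pos[of 1] by (simp add: q0 field_simps)
  qed
  have step: "q (j + 2) x = ((x - of_real (b (j + 2))) * q (j + 1) x - of_real (a (j + 1)) * q j x) / of_real (a (j + 2))"
    for j x
  proof -
    have "x * q (j + 1) x = of_real (a (j + 1 + 1)) * q (j + 1 + 1) x + of_real (b (j + 1 + 1)) * q (j + 1) x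
        + of_real (a (j + 1)) * q (j + 1 - 1) x"
      using q[of x] unfolding jacobi_solution_def by (metis le_add2)
    then show ?thesis using pos[of "j + 2"] by (simp add: field_simps)
  qed
  have "(q j holomorphic_on UNIV \<and> q j (cnj x) = cnj (q j x)) \<and>
      (q (j + 1) holomorphic_on UNIV \<and> q (j + 1) (cnj x) = cnj (q (j + 1) x))"
  proof (induction j)
    case 0
    have "q 0 = (\<lambda>_. 0)" "q 1 = (\<lambda>_. 1 / of_real (a 1))" using q0 q1 by auto
    then show ?case by simp
  next
    case (Suc j)
    have "q (j + 2) = (\<lambda>x. ((x - of_real (b (j + 2))) * q (j + 1) x - of_real (a (j + 1)) * q j x) / of_real (a (j + 2)))"
      using step by auto
    moreover have "\<dots> holomorphic_on UNIV"
      using Suc.IH pos[of "j + 2"] by (intro holomorphic_intros) auto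
    moreover have "q (j + 2) (cnj x) = cnj (q (j + 2) x)" unfolding step using Suc.IH by simp
    ultimately show ?case using Suc.IH by simp
  qed
  then show "second_kind \<mu> (p j) holomorphic_on UNIV"
    and "second_kind \<mu> (p j) (cnj x) = cnj (second_kind \<mu> (p j) x)"
    by (simp_all add: q_def)
qed

text \<open>
  By coefficient stripping \<open>Im F\<^sub>t = - \<epsilon> - Im (1 / F)\<close> at \<open>x0 + \<i> \<epsilon>\<close>, where \<open>F\<^sub>t\<close> is the transform of
  the scaled measure, and \<open>- Im (1 / L) = Im L / |L|\<^sup>2\<close>.
\<close>

lemma stripped_boundary_weight:
  assumes \<mu>: "nontrivial_cpt_prob_measure \<mu>" and ab: "jacobi_parameters \<mu> a b"
    and \<mu>': "nontrivial_cpt_prob_measure \<mu>'"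
    and ab': "jacobi_parameters \<mu>' (\<lambda>n. a (n + 1)) (\<lambda>n. b (n + 1))"
    and L: "((\<lambda>\<epsilon>. stieltjes_transform \<mu> (Complex x0 \<epsilon>)) \<longlongrightarrow> L) (at_right 0)" and "L \<noteq> 0"
  shows "boundary_weight (scale_measure (ennreal ((a 1)\<^sup>2)) \<mu>') x0 = Im L / (pi * (cmod L)\<^sup>2)"
proof -
  define F where "F = (\<lambda>\<epsilon>. stieltjes_transform \<mu> (Complex x0 \<epsilon>))"
  define Ft where "Ft = (\<lambda>\<epsilon>. stieltjes_transform (scale_measure (ennreal ((a 1)\<^sup>2)) \<mu>') (Complex x0 \<epsilon>))"
  have scale: "stieltjes_transform (scale_measure (ennreal ((a 1)\<^sup>2)) \<mu>') z =
      of_real ((a 1)\<^sup>2) * stieltjes_transform \<mu>' z" if z: "Im z \<noteq> 0" for z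
  proof -
    have dens: "scale_measure (ennreal ((a 1)\<^sup>2)) \<mu>' = density \<mu>' (\<lambda>_. ennreal ((a 1)\<^sup>2))"
      by (rule measure_eqI) (auto simp: emeasure_density nn_integral_cmult_indicator)
    have meas: "(\<lambda>t. 1 / (complex_of_real t - z)) \<in> borel_measurable \<mu>'"
      using integrable_resolvent[OF \<mu>' z] by (rule borel_measurable_integrable)
    have int: "(LINT t|density \<mu>' (\<lambda>_. ennreal ((a 1)\<^sup>2)). 1 / (complex_of_real t - z)) =
        (LINT t|\<mu>'. (a 1)\<^sup>2 *\<^sub>R (1 / (complex_of_real t - z)))"
      using meas by (rule integral_density) auto
    show ?thesis
      unfolding stieltjes_transform_def dens int
      by (simp only: integral_mult_right_zero scaleR_conv_of_real)
  qed
  have FL: "(F \<longlongrightarrow> L) (at_right 0)" using L by (simp add: F_def)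
  have "\<forall>\<^sub>F \<epsilon> in at_right 0. F \<epsilon> \<noteq> 0"
    using FL \<open>L \<noteq> 0\<close> by (rule tendsto_imp_eventually_ne)
  moreover have "\<forall>\<^sub>F \<epsilon> in at_right (0 :: real). \<epsilon> > 0" by (rule eventually_at_right_less)
  ultimately have "\<forall>\<^sub>F \<epsilon> in at_right 0. - \<epsilon> - Im (1 / F \<epsilon>) = Im (Ft \<epsilon>)"
  proof eventually_elim
    case (elim \<epsilon>)
    have sc: "Ft \<epsilon> = of_real ((a 1)\<^sup>2) * stieltjes_transform \<mu>' (Complex x0 \<epsilon>)"
      unfolding Ft_def using elim by (intro scale) simp
    have "(Complex x0 \<epsilon> - of_real (b 1)) * F \<epsilon> + 1 = - (Ft \<epsilon> * F \<epsilon>)"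
      unfolding sc F_def using elim by (intro coefficient_stripping[OF \<mu> ab \<mu>' ab']) simp
    then have "Ft \<epsilon> = of_real (b 1) - Complex x0 \<epsilon> - 1 / F \<epsilon>"
      using elim by (simp add: field_simps)
    then show ?case by simp
  qed
  moreover have "((\<lambda>\<epsilon>. - \<epsilon> - Im (1 / F \<epsilon>)) \<longlongrightarrow> - 0 - Im (1 / L)) (at_right 0)"
    using \<open>L \<noteq> 0\<close> by (intro tendsto_intros FL)
  ultimately have "((\<lambda>\<epsilon>. Im (Ft \<epsilon>)) \<longlongrightarrow> - Im (1 / L)) (at_right 0)"
    using Lim_transform_eventually by fastforce
  then have "boundary_weight (scale_measure (ennreal ((a 1)\<^sup>2)) \<mu>') x0 = 1 / pi * - Im (1 / L)"
    unfolding boundary_weight_def Ft_def by (subst tendsto_Lim) auto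
  also have "- Im (1 / L) = Im L / (cmod L)\<^sup>2" by (simp add: Im_divide cmod_power2)
  finally show ?thesis by simp
qed

theorem theorem1p3:
  fixes \<mu> \<mu>' \<mu>t :: "real measure"
    and w wt :: "real \<Rightarrow> real"
    and p :: "nat \<Rightarrow> real poly"
    and a b :: "nat \<Rightarrow> real"
    and x0 \<rho> :: real
  assumes "nontrivial_cpt_prob_measure \<mu>"
    and "is_ac_weight \<mu> w"
    and "orthonormal_polys \<mu> p"
    and "jacobi_parameters \<mu> a b"
    and "nontrivial_cpt_prob_measure \<mu>'"
    and "jacobi_parameters \<mu>' (\<lambda>n. a (n + 1)) (\<lambda>n. b (n + 1))"
    and "\<mu>t = scale_measure (ennreal ((a 1)\<^sup>2)) \<mu>'"
    and "is_ac_weight \<mu>t wt"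
    and "wt x0 = boundary_weight \<mu>t x0"
    and "strong_Lebesgue_point \<mu> w x0"
    and "\<rho> > 0"
    and "sine_kernel_limit (CD_kernel p) x0 \<rho> (w x0)"
  shows "wt x0 \<noteq> 0 \<and> sine_kernel_limit (second_kind_CD_kernel \<mu> p) x0 \<rho> (wt x0)"
proof -
  note \<mu> = assms(1) and p = assms(3) and ab = assms(4)
  obtain L where L: "((\<lambda>\<epsilon>. stieltjes_transform \<mu> (Complex x0 \<epsilon>)) \<longlongrightarrow> L) (at_right 0)"
    and w: "w x0 > 0"
    using assms(10) unfolding strong_Lebesgue_point_def by blast
  define c where "c = pi * \<rho>"
  define v where "v = pi * w x0"
  define s where "s = 1 / (2 * \<rho>)"
  have c: "c > 0" and v: "v > 0" and s: "c * s = pi / 2"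
    using \<open>\<rho> > 0\<close> w by (simp_all add: c_def v_def s_def)
  define X where "X = (\<lambda>n a. of_real x0 + a / of_nat n :: complex)"
  define P where "P = (\<lambda>x j. cpoly (p j) x)"
  define Q where "Q = (\<lambda>x j. second_kind \<mu> (p j) x)"
  have P: "jacobi_solution a b x 0 (P x)" "P x 0 = 1" for x
    using first_kind_jacobi_solution[OF \<mu> p ab] by (simp_all add: P_def)
  have Q: "jacobi_solution a b x 1 (Q x)" "Q x 0 = 0" for x
    using second_kind_jacobi_solution[OF \<mu> p ab] by (simp_all add: Q_def)
  have Pcnj: "P (cnj x) = (\<lambda>j. cnj (P x j))" and Qcnj: "Q (cnj x) = (\<lambda>j. cnj (Q x j))" for x
    using second_kind_entire(2)[OF \<mu> p ab] by (auto simp: P_def Q_def cpoly_cnj)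
  have Phol: "(\<lambda>x. P x j) holomorphic_on UNIV" for j
    unfolding P_def by (intro holomorphic_intros)
  have Qhol: "(\<lambda>x. Q x j) holomorphic_on UNIV" for j
    using second_kind_entire(1)[OF \<mu> p ab] by (simp add: Q_def)
  have Xcnj: "X n (cnj x) = cnj (X n x)" for n x by (simp add: X_def)
  have Xdiff: "(X n x - X n y) * S = (x - y) * (S / of_nat n)" for n x y S
    by (simp add: X_def diff_divide_distrib[symmetric])
  have Xhol: "(\<lambda>x. f (X n (x + d))) holomorphic_on UNIV" if "f holomorphic_on UNIV" for f n d
  proof -
    have "(f \<circ> (\<lambda>x. X n (x + d))) holomorphic_on UNIV"
      using that unfolding X_def divide_inverse
      by (intro holomorphic_on_compose_gen[of _ _ _ UNIV] holomorphic_intros) auto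
    then show ?thesis by (simp add: o_def)
  qed
  define K where "K = (\<lambda>n x y. CD_kernel p n (X n x) (X n y) / of_nat n)"
  define Kt where "Kt = (\<lambda>n x y. second_kind_CD_kernel \<mu> p n (X n x) (X n y) / of_nat n)"
  define k where "k = (\<lambda>n x y. (x - y) * K n x y)"
  define G where "G = (\<lambda>n x. wronskian a n (Q (X n x)) (P (X n (x + of_real s))))"
  define \<Phi> where "\<Phi> = (\<lambda>n x. stieltjes_transform \<mu> (X n x))"
  have K: "uniform_limit (C \<times> C) (\<lambda>n (a, b). K n a b)
      (\<lambda>(a, b). sin_quotient c (b - a) / of_real v) sequentially" if "compact C" for C
    using assms(12) that unfolding sine_kernel_limit_def K_def X_def c_def v_def by blast
  have kW: "k n x y = wronskian a n (P (X n x)) (P (X n y))" if "n \<ge> 1" for n x y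
    using christoffel_darboux[OF P(1) P(1) that, of "X n x" "X n y"]
    by (simp add: k_def K_def CD_kernel_def P_def Xdiff)
  have KtW: "(x - y) * Kt n x y = wronskian a n (Q (X n x)) (Q (X n y))" if "n \<ge> 1" for n x y
    using christoffel_darboux[OF Q(1) Q(1) that, of "X n x" "X n y"] Q(2)
    by (simp add: Kt_def second_kind_CD_kernel_def Q_def Xdiff)
  have W1: "wronskian a n (Q x) (P x) = 1" if "n \<ge> 1" for n x
    using christoffel_darboux[OF Q(1) P(1) that, of x x] P(2) by simp
  \<comment> \<open>Pluecker relations: with \<open>[Q x, P x] = 1\<close>, the two Wronskians \<open>[Q x, P y]\<close> and \<open>[Q x, Q y]\<close> are
    expressed by \<open>k\<close> and \<open>G\<close>.\<close>
  have QP: "wronskian a n (Q (X n x)) (P (X n y)) * k n x (x + of_real s) =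
      k n y (x + of_real s) + G n x * k n x y" if n: "n \<ge> 1" for n x y
    using wronskian_pluecker[of a n "Q (X n x)" "P (X n x)" "P (X n y)" "P (X n (x + of_real s))"]
      W1[OF n, of "X n x"] unfolding kW[OF n] G_def by algebra
  have QQ: "(x - y) * Kt n x y * (k n x (x + of_real s) * k n y (y + of_real s)) =
      k n (x + of_real s) (y + of_real s) + G n y * k n y (x + of_real s)
      - G n x * k n x (y + of_real s) - G n x * G n y * k n y x" if n: "n \<ge> 1" for n x y
  proof -
    have "wronskian a n (Q (X n x)) (Q (X n y)) * k n x (x + of_real s) =
        wronskian a n (Q (X n y)) (P (X n (x + of_real s))) - G n x * wronskian a n (Q (X n y)) (P (X n x))"
      using wronskian_pluecker[of a n "Q (X n x)" "Q (X n y)" "P (X n x)" "P (X n (x + of_real s))"]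
        W1[OF n, of "X n x"] unfolding kW[OF n] G_def by algebra
    with QP[OF n, of y x] QP[OF n, of y "x + of_real s"] show ?thesis
      unfolding KtW[OF n] by algebra
  qed
  have Ghol: "G n holomorphic_on UNIV" for n
    unfolding G_def wronskian_def
    using Xhol[OF Qhol, where d = 0, simplified] Xhol[OF Phol] by (intro holomorphic_intros)
  have Kthol: "(\<lambda>x. Kt n x y) holomorphic_on UNIV" for n y
  proof -
    have "(\<lambda>x. \<Sum>j<n. Q (X n x) j * Q (X n y) j * inverse (of_nat n)) holomorphic_on UNIV"
      using Xhol[OF Qhol, where d = 0, simplified] by (intro holomorphic_intros)
    then show ?thesis
      by (simp add: Kt_def second_kind_CD_kernel_def Q_def divide_inverse sum_distrib_right)
  qed
  have Greal: "\<forall>\<^sub>F n in sequentially. \<forall>x. G n (cnj x) = cnj (G n x)"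
  proof (intro always_eventually allI)
    fix n x
    have "X n (cnj x + of_real s) = cnj (X n (x + of_real s))" using Xcnj[of n "x + of_real s"] by simp
    then show "G n (cnj x) = cnj (G n x)" by (simp add: G_def Xcnj Pcnj Qcnj wronskian_cnj)
  qed
  have disc: "\<forall>\<^sub>F n in sequentially. \<forall>x. Im x > 0 \<longrightarrow>
        cmod ((G n x + \<Phi> n x * k n x (x + of_real s)) * k n x (cnj x) - k n (x + of_real s) (cnj x))
          \<le> cmod (k n x (x + of_real s))"
    using eventually_ge_at_top[of 1]
  proof eventually_elim
    case (elim n)
    show ?case
    proof (intro allI impI)
      fix x assume x: "Im x > 0"
      define z where "z = X n x"
      have z: "Im z > 0" using x elim by (simp add: z_def X_def)
      have "(\<Sum>j<n. (cmod (Q z j + \<Phi> n x * P z j))\<^sup>2) \<le> Im (\<Phi> n x) / Im z"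
        using weyl_solution_sum_le[OF \<mu> p, of z n] z
        by (simp add: weyl_solution_def Q_def P_def \<Phi>_def z_def)
      from weyl_disc[OF P(1) Q(1) P(2) Q(2) elim z this]
      have "cmod (wronskian a n (Q (X n x)) (P (X n (cnj x))) + \<Phi> n x * k n x (cnj x)) \<le> 1"
        unfolding kW[OF elim] Xcnj Pcnj z_def .
      then have "cmod ((wronskian a n (Q (X n x)) (P (X n (cnj x))) + \<Phi> n x * k n x (cnj x)) * k n x (x + of_real s))
          \<le> 1 * cmod (k n x (x + of_real s))"
        unfolding norm_mult by (rule mult_right_mono) simp
      \<comment> \<open>Multiplying the Weyl disc by \<open>k n x (x + s)\<close> replaces \<open>[Q x, P (cnj x)]\<close> by \<open>G\<close>, which is
        holomorphic in \<open>x\<close>.\<close>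
      moreover have "k n (cnj x) (x + of_real s) = - k n (x + of_real s) (cnj x)"
        unfolding kW[OF elim] by (rule wronskian_commute)
      then have "(wronskian a n (Q (X n x)) (P (X n (cnj x))) + \<Phi> n x * k n x (cnj x)) * k n x (x + of_real s) =
          (G n x + \<Phi> n x * k n x (x + of_real s)) * k n x (cnj x) - k n (x + of_real s) (cnj x)"
        using QP[OF elim, of x "cnj x"] by algebra
      ultimately show "cmod ((G n x + \<Phi> n x * k n x (x + of_real s)) * k n x (cnj x) - k n (x + of_real s) (cnj x))
          \<le> cmod (k n x (x + of_real s))" by simp
    qed
  qed
  obtain M where M: "M \<ge> 0" "\<forall>\<^sub>F n in sequentially. \<forall>a. Im a > 0 \<longrightarrow>
        cmod (\<Phi> n a) \<le> M * (1 + cmod (a - \<i>) * (1 + cmod (a - \<i>) / Im a))"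
    using stieltjes_transform_rescaled_bound[OF \<mu> L] unfolding \<Phi>_def X_def by blast
  have \<Phi>: "(\<lambda>n. \<Phi> n x) \<longlonglongrightarrow> L" if "Im x > 0" for x
    using stieltjes_transform_rescaled_limit[OF \<mu> L that] by (simp add: \<Phi>_def X_def)
  have kdef: "k n x y = (x - y) * K n x y" for n x y by (simp add: k_def)
  note discs = weyl_discs_converge[OF K c v s kdef Ghol Greal disc M(2,1) \<Phi>]
  have ImL: "Im L = v" by (rule discs(1))
  define \<gamma> where "\<gamma> = Re L / v"
  have G: "uniform_limit C G (\<lambda>_. of_real \<gamma>) sequentially" if "compact C" for C
    unfolding \<gamma>_def by (rule discs(2)) (use that in auto)
  have "L \<noteq> 0" using ImL v by auto
  then have wt: "wt x0 = v / (pi * (cmod L)\<^sup>2)"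
    using stripped_boundary_weight[OF \<mu> ab assms(5,6) L] assms(7,9) ImL by simp
  then have wt0: "wt x0 \<noteq> 0" using v \<open>L \<noteq> 0\<close> by simp
  \<comment> \<open>The constant of the limit kernel: \<open>v\<^sup>2 (1 + \<gamma>\<^sup>2) = |L|\<^sup>2\<close> because \<open>v = Im L\<close> and \<open>\<gamma> v = Re L\<close>.\<close>
  have const: "v * (1 + \<gamma>\<^sup>2) = 1 / (pi * wt x0)"
  proof -
    have "(cmod L)\<^sup>2 = v\<^sup>2 + (Re L)\<^sup>2" by (simp add: cmod_power2 ImL)
    then show ?thesis using v by (simp add: wt \<gamma>_def field_simps power2_eq_square)
  qed
  have eq: "\<forall>\<^sub>F n in sequentially. \<forall>x y.
        (x - y) * Kt n x y * (k n x (x + of_real s) * k n y (y + of_real s)) =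
          k n (x + of_real s) (y + of_real s) + G n y * k n y (x + of_real s)
          - G n x * k n x (y + of_real s) - G n x * G n y * k n y x"
    using eventually_ge_at_top[of 1] by eventually_elim (use QQ in blast)
  have "uniform_limit (C \<times> C) (\<lambda>n (a, b). Kt n a b)
      (\<lambda>(a, b). of_real (v * (1 + \<gamma>\<^sup>2)) * sin_quotient c (b - a)) sequentially" if "compact C" for C
    by (rule second_kernel_limit[OF K v s kdef G Kthol eq that])
  then have "sine_kernel_limit (second_kind_CD_kernel \<mu> p) x0 \<rho> (wt x0)"
    unfolding sine_kernel_limit_def const Kt_def X_def c_def by (simp add: mult.commute)
  with wt0 show ?thesis by blast
qed

end
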